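(* Fix $m\ge2$, dates $0=t_0<t_1<\dots<t_m$, a Markov process $S$, and basis functions $\psi_{nk}$, and consider for each $K$ the continuation-value approximations $C_n$ and their Monte Carlo estimates $\hat C_n$ from $N$ paths per date, as defined in the context. Suppose that conditions (A0), (B1), (B2), (B3) stated in the context hold (for every $K$). Then for each $n=1,\dots,m-1$, $$\mathsf{E}\big[\|\hat C_n-C_n\|_n^2\big]\le(2^{m-n}-1)\,\frac{(K+1)^2}{N}\,B_K\,A_K^{m-n}\,\big(\mathsf{E}[\psi_{mK}^2(S_m)]\big)^2\,(1+o(1)),$$ where $o(1)$ denotes a quantity depending on $K$ but not on $N$ that tends to $0$ as $K\to\infty$.
   Context: Setting. $\{S(t)\}$ is an $\mathbb{R}^d$-valued Markov process with $S(0)$ fixed; $S_n=S(t_n)$, and for $n\ge1$, $S_n$ has density $g_n$. The payoff functions are $h_n:\mathbb{R}^d\to[0,\infty)$, $n=0,\dots,m$ (they may depend on $K$). For $n=1,\dots,m$ and $k=0,1,2,\dots$, $\psi_{nk}:\mathbb{R}^d\to\mathbb{R}$ are basis functions; for given $K$, $\psi_n=(\psi_{n0},\dots,\psi_{nK})^\top$ and $\Psi_n=\mathsf{E}[\psi_n(S_n)\psi_n(S_n)^\top]$. All expectations appearing are assumed finite. $|x|$ is the Euclidean norm of a vector, $\|A\|$ is the Euclidean (Frobenius) norm of a matrix $A$, and for a function $G:\mathbb{R}^d\to\mathbb{R}$, $\|G\|_n=\sqrt{\int G(x)^2g_n(x)\,dx}$. Exact approximation. $C_m\equiv0$, and for $n=m-1,\dots,1$,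 $$V_{n+1}=\max\{h_{n+1},C_{n+1}\},\quad \gamma_n=\mathsf{E}[V_{n+1}(S_{n+1})\psi_n(S_n)],\quad \beta_n=\Psi_n^{-1}\gamma_n,\quad C_n(x)=\beta_n^\top\psi_n(x).$$ Estimated approximation. $\hat C_m\equiv0$, $\hat V_m=h_m$. For $n=m-1,\dots,1$: generate $N$ paths $\{S_1^{(i)},\dots,S_{n+1}^{(i)}\}$, $i=1,\dots,N$, of the process, independent of each other and of all previously generated paths; set $$\hat\gamma_n=\frac1N\sum_{i=1}^N\hat V_{n+1}(S_{n+1}^{(i)})\psi_n(S_n^{(i)}),\quad \hat\beta_n=\Psi_n^{-1}\hat\gamma_n,\quad \hat C_n=\hat\beta_n^\top\psi_n,\quad \hat V_n=\max\{h_n,\hat C_n\}.$$ Conditions. (A0) $\psi_{n0}\equiv1$ for $n=1,\dots,m$; $\mathsf{E}[\psi_{nk}(S_n)]=0$ for $n=1,\dots,m$ and $k\ge1$; and $\Psi_n$ is finite and nonsingular, $n=1,\dots,m$. (B1) $\mathsf{E}[\psi_{nk}^2(S_n)]$ and $\mathsf{E}[\psi_{nk}^4(S_n)]$ are increasing (i.e. nondecreasing) in $n$ and in $k$. (B2) $|\beta_{m-1}|=1$. (B3) $\mathsf{E}[h_n^4(S_n)]\le\left(\frac{t_n}{t_{n-1}}\right)^{2K}\mathsf{E}[\psi_{nK}^4(S_n)]$ for $n=2,\dots,m$. Constants. $$c=\max_{n=1,\dots,m-1}\frac{t_{n+1}}{t_n},\quad B_K=\max_{n=1,\dots,m-1}\|\Psi_n^{-1}\|,\quad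 H_K=\max\{c^K,B_K^2(K+1)\},\quad A_K=(K+1)H_K\,\mathsf{E}[\psi_{mK}^4(S_m)].$$ *)

theory Defs
  imports "HOL-Probability.Probability" "Jordan_Normal_Form.Gauss_Jordan_Elimination"
begin

definition natural_filtration ::
    "'w measure \<Rightarrow> (real \<Rightarrow> 'w \<Rightarrow> 'a::topological_space) \<Rightarrow> real \<Rightarrow> 'w measure" where
  "natural_filtration M S s =
     sigma (space M) (\<Union>u\<in>{0..s}. {S u -` A \<inter> space M |A. A \<in> sets borel})"

definition markov_process ::
    "'w measure \<Rightarrow> (real \<Rightarrow> 'w \<Rightarrow> 'a::topological_space) \<Rightarrow> bool" where
  "markov_process M S \<longleftrightarrow>
     (\<forall>u\<ge>0. S u \<in> M \<rightarrow>\<^sub>M borel) \<and>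
     (\<forall>s u A. 0 \<le> s \<longrightarrow> s \<le> u \<longrightarrow> A \<in> sets borel \<longrightarrow>
        (AE \<omega> in M.
           real_cond_exp M (natural_filtration M S s) (indicator (S u -` A \<inter> space M)) \<omega> =
           real_cond_exp M (vimage_algebra (space M) (S s) borel)
             (indicator (S u -` A \<inter> space M)) \<omega>))"

definition weighted_norm :: "('a::euclidean_space \<Rightarrow> real) \<Rightarrow> ('a \<Rightarrow> real) \<Rightarrow> real" where
  "weighted_norm w G = sqrt (LINT x|lborel. (G x)\<^sup>2 * w x)"

definition euclid_norm :: "real vec \<Rightarrow> real" where
  "euclid_norm v = sqrt (\<Sum>i<dim_vec v. (vec_index v i)\<^sup>2)"

definition frobenius_norm :: "real mat \<Rightarrow> real" where
  "frobenius_norm A = sqrt (\<Sum>i<dim_row A. \<Sum>j<dim_col A. (A $$ (i, j))\<^sup>2)"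

text \<open>\<^const>\<open>mat_inverse\<close> returns \<^const>\<open>None\<close> on a singular matrix, so \<open>mat_inv\<close> is only
  meaningful for nonsingular ones.\<close>

definition mat_inv :: "real mat \<Rightarrow> real mat" where
  "mat_inv A = the (mat_inverse A)"

definition basis_vec :: "(nat \<Rightarrow> nat \<Rightarrow> 'a \<Rightarrow> real) \<Rightarrow> nat \<Rightarrow> nat \<Rightarrow> 'a \<Rightarrow> real vec" where
  "basis_vec \<psi> K n x = vec (K + 1) (\<lambda>k. \<psi> n k x)"

definition gram ::
    "'w measure \<Rightarrow> (real \<Rightarrow> 'w \<Rightarrow> 'a) \<Rightarrow> (nat \<Rightarrow> real) \<Rightarrow> (nat \<Rightarrow> nat \<Rightarrow> 'a \<Rightarrow> real) \<Rightarrow>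
     nat \<Rightarrow> nat \<Rightarrow> real mat" where
  "gram M S t \<psi> K n =
     mat (K + 1) (K + 1) (\<lambda>(j, k). LINT \<omega>|M. \<psi> n j (S (t n) \<omega>) * \<psi> n k (S (t n) \<omega>))"

text \<open>The exact and the estimated approximation share one backward recursion and differ only in
  the rule \<open>b\<close> that computes the coefficient vector of date \<open>n\<close> from the value function \<open>V\<close> of
  date \<open>n + 1\<close>. At the last date the continuation value is \<open>0\<close>, so the value function there is
  \<open>max (h m) 0\<close>, which is \<open>h m\<close> for nonnegative payoffs.\<close>

function cont_value ::
    "nat \<Rightarrow> (nat \<Rightarrow> 'a \<Rightarrow> real) \<Rightarrow> (nat \<Rightarrow> nat \<Rightarrow> 'a \<Rightarrow> real) \<Rightarrow> nat \<Rightarrow>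
     (nat \<Rightarrow> ('a \<Rightarrow> real) \<Rightarrow> real vec) \<Rightarrow> nat \<Rightarrow> 'a \<Rightarrow> real" where
  "cont_value m h \<psi> K b n =
     (if n < m
      then (let C' = cont_value m h \<psi> K b (n + 1);
                V' = (\<lambda>x. max (h (n + 1) x) (C' x))
            in (\<lambda>x. scalar_prod (b n V') (basis_vec \<psi> K n x)))
      else (\<lambda>x. 0))"
  by auto
termination
  by (relation "Wellfounded.measure (\<lambda>(m, h, \<psi>, K, b, n). m - n)") auto

declare cont_value.simps [simp del]

definition exact_coef ::
    "'w measure \<Rightarrow> (real \<Rightarrow> 'w \<Rightarrow> 'a) \<Rightarrow> (nat \<Rightarrow> real) \<Rightarrow> (nat \<Rightarrow> nat \<Rightarrow> 'a \<Rightarrow> real) \<Rightarrow> nat \<Rightarrow>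
     nat \<Rightarrow> ('a \<Rightarrow> real) \<Rightarrow> real vec" where
  "exact_coef M S t \<psi> K n V =
     mat_inv (gram M S t \<psi> K n) *\<^sub>v
       vec (K + 1) (\<lambda>k. LINT \<omega>|M. V (S (t (n + 1)) \<omega>) * \<psi> n k (S (t n) \<omega>))"

definition exact_cont ::
    "'w measure \<Rightarrow> (real \<Rightarrow> 'w \<Rightarrow> 'a) \<Rightarrow> (nat \<Rightarrow> real) \<Rightarrow> nat \<Rightarrow> (nat \<Rightarrow> 'a \<Rightarrow> real) \<Rightarrow>
     (nat \<Rightarrow> nat \<Rightarrow> 'a \<Rightarrow> real) \<Rightarrow> nat \<Rightarrow> nat \<Rightarrow> 'a \<Rightarrow> real" where
  "exact_cont M S t m h \<psi> K n = cont_value m h \<psi> K (exact_coef M S t \<psi> K) n"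

definition exact_beta ::
    "'w measure \<Rightarrow> (real \<Rightarrow> 'w \<Rightarrow> 'a) \<Rightarrow> (nat \<Rightarrow> real) \<Rightarrow> nat \<Rightarrow> (nat \<Rightarrow> 'a \<Rightarrow> real) \<Rightarrow>
     (nat \<Rightarrow> nat \<Rightarrow> 'a \<Rightarrow> real) \<Rightarrow> nat \<Rightarrow> nat \<Rightarrow> real vec" where
  "exact_beta M S t m h \<psi> K n =
     exact_coef M S t \<psi> K n
       (\<lambda>x. max (h (n + 1) x) (exact_cont M S t m h \<psi> K (n + 1) x))"

text \<open>\<open>Y n i \<omega> j\<close> is the state at date \<open>t j\<close> of the \<open>i\<close>-th path simulated for date \<open>n\<close>; that path
  runs through the dates \<open>1, \<dots>, n + 1\<close>, and paths are independent over all pairs \<open>(n, i)\<close>.\<close>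

definition simulated_paths ::
    "'w measure \<Rightarrow> (real \<Rightarrow> 'w \<Rightarrow> 'a::topological_space) \<Rightarrow> (nat \<Rightarrow> real) \<Rightarrow> nat \<Rightarrow> nat \<Rightarrow>
     'b measure \<Rightarrow> (nat \<Rightarrow> nat \<Rightarrow> 'b \<Rightarrow> nat \<Rightarrow> 'a) \<Rightarrow> bool" where
  "simulated_paths M S t m N Q Y \<longleftrightarrow>
     prob_space Q \<and>
     prob_space.indep_vars Q (\<lambda>(n, i). PiM {1..n + 1} (\<lambda>_. borel)) (\<lambda>(n, i). Y n i)
       ({1..m - 1} \<times> {1..N}) \<and>
     (\<forall>n\<in>{1..m - 1}. \<forall>i\<in>{1..N}.
        distr Q (PiM {1..n + 1} (\<lambda>_. borel)) (Y n i) =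
        distr M (PiM {1..n + 1} (\<lambda>_. borel)) (\<lambda>\<omega>. \<lambda>j\<in>{1..n + 1}. S (t j) \<omega>))"

text \<open>The matrix inverted here is the exact one, not a sample estimate of it.\<close>

definition est_coef ::
    "'w measure \<Rightarrow> (real \<Rightarrow> 'w \<Rightarrow> 'a) \<Rightarrow> (nat \<Rightarrow> real) \<Rightarrow> (nat \<Rightarrow> nat \<Rightarrow> 'a \<Rightarrow> real) \<Rightarrow> nat \<Rightarrow>
     nat \<Rightarrow> (nat \<Rightarrow> nat \<Rightarrow> nat \<Rightarrow> 'a) \<Rightarrow> nat \<Rightarrow> ('a \<Rightarrow> real) \<Rightarrow> real vec" where
  "est_coef M S t \<psi> K N y n V =
     mat_inv (gram M S t \<psi> K n) *\<^sub>v
       vec (K + 1) (\<lambda>k. (\<Sum>i=1..N. V (y n i (n + 1)) * \<psi> n k (y n i n)) / real N)"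

definition est_cont ::
    "'w measure \<Rightarrow> (real \<Rightarrow> 'w \<Rightarrow> 'a) \<Rightarrow> (nat \<Rightarrow> real) \<Rightarrow> nat \<Rightarrow> (nat \<Rightarrow> 'a \<Rightarrow> real) \<Rightarrow>
     (nat \<Rightarrow> nat \<Rightarrow> 'a \<Rightarrow> real) \<Rightarrow> nat \<Rightarrow> nat \<Rightarrow> (nat \<Rightarrow> nat \<Rightarrow> nat \<Rightarrow> 'a) \<Rightarrow> nat \<Rightarrow> 'a \<Rightarrow> real" where
  "est_cont M S t m h \<psi> K N y n = cont_value m h \<psi> K (est_coef M S t \<psi> K N y) n"

definition const_c :: "(nat \<Rightarrow> real) \<Rightarrow> nat \<Rightarrow> real" where
  "const_c t m = Max ((\<lambda>n. t (n + 1) / t n) ` {1..m - 1})"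

definition const_B ::
    "'w measure \<Rightarrow> (real \<Rightarrow> 'w \<Rightarrow> 'a) \<Rightarrow> (nat \<Rightarrow> real) \<Rightarrow> nat \<Rightarrow>
     (nat \<Rightarrow> nat \<Rightarrow> 'a \<Rightarrow> real) \<Rightarrow> nat \<Rightarrow> real" where
  "const_B M S t m \<psi> K =
     Max ((\<lambda>n. frobenius_norm (mat_inv (gram M S t \<psi> K n))) ` {1..m - 1})"

definition const_H ::
    "'w measure \<Rightarrow> (real \<Rightarrow> 'w \<Rightarrow> 'a) \<Rightarrow> (nat \<Rightarrow> real) \<Rightarrow> nat \<Rightarrow>
     (nat \<Rightarrow> nat \<Rightarrow> 'a \<Rightarrow> real) \<Rightarrow> nat \<Rightarrow> real" where
  "const_H M S t m \<psi> K = max (const_c t m ^ K) ((const_B M S t m \<psi> K)\<^sup>2 * (real K + 1))"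

definition const_A ::
    "'w measure \<Rightarrow> (real \<Rightarrow> 'w \<Rightarrow> 'a) \<Rightarrow> (nat \<Rightarrow> real) \<Rightarrow> nat \<Rightarrow>
     (nat \<Rightarrow> nat \<Rightarrow> 'a \<Rightarrow> real) \<Rightarrow> nat \<Rightarrow> real" where
  "const_A M S t m \<psi> K =
     (real K + 1) * const_H M S t m \<psi> K * (LINT \<omega>|M. (\<psi> m K (S (t m) \<omega>)) ^ 4)"

end

theory Submission
  imports Defs
begin

text \<open>Write \<open>P\<close> for the inverse Gram matrix and \<open>\<delta>\<close> for the error of the estimated moment vector
  \<open>\<gamma>_est\<close>. Since \<open>P\<close> inverts the Gram matrix, the squared norm of the error of date \<open>n\<close> is
  \<open>(P \<delta>) \<bullet> \<delta> \<le> B \<bar>\<delta>\<bar>\<^sup>2\<close>, so only \<open>\<gamma>_est\<close> has to be estimated. Conditionally on the paths of the later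
  dates it is an average of \<open>N\<close> independent identically distributed terms, hence with
  \<open>w n = E \<bar>\<gamma>_est n\<bar>\<^sup>2\<close>, \<open>e n = E \<bar>\<delta> n\<bar>\<^sup>2\<close>, \<open>p = E \<psi>\<^sub>m\<^sub>K\<^sup>2\<close>, \<open>q = E \<psi>\<^sub>m\<^sub>K\<^sup>4\<close> and Cauchy-Schwarz

  \<open>w n \<le> (K + 1) c\<^sup>K q + (K + 1)\<^sup>2 q B\<^sup>2 w (n + 1) \<le> A + A w (n + 1)\<close>,

  \<open>e n \<le> w n / N + (K + 1) p B e (n + 1) \<le> w n / N + A e (n + 1)\<close>,

  where the right-hand inequalities use \<open>B \<ge> 1\<close> and \<open>q \<ge> p\<^sup>2 \<ge> 1\<close>. Backward induction gives
  \<open>w n \<le> j A\<^sup>j\<close> with \<open>j = m - n\<close> and then, as \<open>j \<le> 2\<^sup>j\<^sup>-\<^sup>1\<close>, the stated bound. Independence from the fresh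
  paths makes fourth moments of the estimated value function unnecessary, and the correction term
  \<open>o(1)\<close> can be taken to be \<open>0\<close>.\<close>

section \<open>Second moments of Monte Carlo averages\<close>

lemma integrable_mult_L2:
  fixes f g :: "'a \<Rightarrow> real"
  assumes [measurable]: "f \<in> borel_measurable M" "g \<in> borel_measurable M"
    and f: "integrable M (\<lambda>x. (f x)\<^sup>2)" and g: "integrable M (\<lambda>x. (g x)\<^sup>2)"
  shows "integrable M (\<lambda>x. f x * g x)"
proof (rule Bochner_Integration.integrable_bound)
  show "integrable M (\<lambda>x. (f x)\<^sup>2 + (g x)\<^sup>2)" using f g by simp
  have "\<bar>a * b\<bar> \<le> a\<^sup>2 + b\<^sup>2" for a b :: real
    using sum_squares_bound[of "\<bar>a\<bar>" "\<bar>b\<bar>"] mult_nonneg_nonneg[of "\<bar>a\<bar>" "\<bar>b\<bar>"]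
    unfolding abs_mult power2_abs by linarith
  then show "AE x in M. norm (f x * g x) \<le> norm ((f x)\<^sup>2 + (g x)\<^sup>2)"
    by simp
qed measurable

lemma integral_Cauchy_Schwarz:
  fixes f g :: "'a \<Rightarrow> real"
  assumes meas: "f \<in> borel_measurable M" "g \<in> borel_measurable M"
    and f: "integrable M (\<lambda>x. (f x)\<^sup>2)" and g: "integrable M (\<lambda>x. (g x)\<^sup>2)"
  shows "(LINT x|M. f x * g x)\<^sup>2 \<le> (LINT x|M. (f x)\<^sup>2) * (LINT x|M. (g x)\<^sup>2)"
proof -
  let ?F = "LINT x|M. (f x)\<^sup>2" and ?G = "LINT x|M. (g x)\<^sup>2" and ?T = "LINT x|M. f x * g x"
  note fg = integrable_mult_L2[OF meas f g]
  \<comment> \<open>The discriminant argument: expanding the integral of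
    \<open>(f - r * g)\<^sup>2\<close> gives a quadratic in \<open>r\<close> that never goes
    negative.\<close>
  have quad: "0 \<le> ?F - 2 * r * ?T + r\<^sup>2 * ?G" for r
  proof -
    have "0 \<le> (LINT x|M. (f x - r * g x)\<^sup>2)" by simp
    also have "\<dots> = (LINT x|M. (f x)\<^sup>2 - 2 * r * (f x * g x) + r\<^sup>2 * (g x)\<^sup>2)"
      by (rule Bochner_Integration.integral_cong) (auto simp: power2_eq_square algebra_simps)
    also have "\<dots> = ?F - 2 * r * ?T + r\<^sup>2 * ?G"
      using f g fg by simp
    finally show ?thesis .
  qed
  show ?thesis
  proof (cases "?G = 0")
    case True
    have "?T = 0"
    proof (rule ccontr)
      assume "?T \<noteq> 0"
      \<comment> \<open>For \<open>?G = 0\<close> the quadratic degenerates to a line in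
        \<open>r\<close>, and this \<open>r\<close> is chosen to give it the value -1.\<close>
      then show False
        using quad[of "(?F + 1) / (2 * ?T)"] True by simp
    qed
    then show ?thesis using True by simp
  next
    case False
    moreover have "0 \<le> ?G" by simp
    ultimately have "0 < ?G" by linarith
    \<comment> \<open>\<open>?T / ?G\<close> is the minimizer of the quadratic; its minimum is
      \<open>?F - ?T\<^sup>2 / ?G\<close>.\<close>
    then show ?thesis
      using quad[of "?T / ?G"] by (simp add: field_simps power2_eq_square)
  qed
qed

section \<open>Independent pairs, and integration with one variable frozen\<close>

context prob_space
begin

text \<open>\<^const>\<open>indep_var\<close> forces both variables to have the same type; this version does not.\<close>

definition indep_pair :: "'u measure \<Rightarrow> ('a \<Rightarrow> 'u) \<Rightarrow> 'x measure \<Rightarrow> ('a \<Rightarrow> 'x) \<Rightarrow> bool" where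
  "indep_pair MU U MX X \<longleftrightarrow> U \<in> M \<rightarrow>\<^sub>M MU \<and> X \<in> M \<rightarrow>\<^sub>M MX \<and>
     distr M MU U \<Otimes>\<^sub>M distr M MX X = distr M (MU \<Otimes>\<^sub>M MX) (\<lambda>\<omega>. (U \<omega>, X \<omega>))"

lemma indep_pair_compose:
  assumes ind: "indep_pair MU U MX X"
    and [measurable]: "f \<in> MU \<rightarrow>\<^sub>M NU" "g \<in> MX \<rightarrow>\<^sub>M NX"
  shows "indep_pair NU (\<lambda>\<omega>. f (U \<omega>)) NX (\<lambda>\<omega>. g (X \<omega>))"
proof -
  have [measurable]: "U \<in> M \<rightarrow>\<^sub>M MU" "X \<in> M \<rightarrow>\<^sub>M MX"
    and law: "distr M MU U \<Otimes>\<^sub>M distr M MX X = distr M (MU \<Otimes>\<^sub>M MX) (\<lambda>\<omega>. (U \<omega>, X \<omega>))"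
    using ind by (auto simp: indep_pair_def)
  have gX: "(\<lambda>\<omega>. g (X \<omega>)) \<in> M \<rightarrow>\<^sub>M NX" by measurable
  have "distr M NU (\<lambda>\<omega>. f (U \<omega>)) \<Otimes>\<^sub>M distr M NX (\<lambda>\<omega>. g (X \<omega>))
      = distr (distr M MU U) NU f \<Otimes>\<^sub>M distr (distr M MX X) NX g"
    by (simp add: distr_distr comp_def)
  also have "\<dots> = distr (distr M MU U \<Otimes>\<^sub>M distr M MX X) (NU \<Otimes>\<^sub>M NX) (\<lambda>(x, y). (f x, g y))"
    by (rule pair_measure_distr)
      (auto intro!: prob_space_imp_sigma_finite prob_space.prob_space_distr[of _ g] prob_space_distr)
  also have "\<dots> = distr M (NU \<Otimes>\<^sub>M NX) (\<lambda>\<omega>. (f (U \<omega>), g (X \<omega>)))"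
    unfolding law by (subst distr_distr) (auto simp: comp_def)
  finally show ?thesis by (simp add: indep_pair_def)
qed

text \<open>Tonelli for the product law: freeze \<open>U\<close> at \<open>u\<close>, bound the
  inner integral over \<open>X\<close>, then integrate the bound. As \<open>f\<close> is
  nonnegative, integrability comes out as a conclusion, so it can be carried along the backward
  induction over the dates.\<close>

lemma indep_pair_integral_le:
  fixes f :: "'u \<times> 'x \<Rightarrow> real"
  assumes ind: "indep_pair MU U MX X"
    and [measurable]: "f \<in> borel_measurable (MU \<Otimes>\<^sub>M MX)" "w \<in> borel_measurable MU"
    and nonneg: "\<And>u x. 0 \<le> f (u, x)"
    and int: "\<And>u. u \<in> space MU \<Longrightarrow> integrable (distr M MX X) (\<lambda>x. f (u, x))"
    and le: "\<And>u. u \<in> space MU \<Longrightarrow> (LINT x|distr M MX X. f (u, x)) \<le> w u"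
    and w: "integrable M (\<lambda>\<omega>. w (U \<omega>))"
  shows "integrable M (\<lambda>\<omega>. f (U \<omega>, X \<omega>))"
    and "expectation (\<lambda>\<omega>. f (U \<omega>, X \<omega>)) \<le> expectation (\<lambda>\<omega>. w (U \<omega>))"
proof -
  have [measurable]: "U \<in> M \<rightarrow>\<^sub>M MU" "X \<in> M \<rightarrow>\<^sub>M MX"
    and law: "distr M MU U \<Otimes>\<^sub>M distr M MX X = distr M (MU \<Otimes>\<^sub>M MX) (\<lambda>\<omega>. (U \<omega>, X \<omega>))"
    using ind by (auto simp: indep_pair_def)
  interpret X: prob_space "distr M MX X" by (rule prob_space_distr) simp
  \<comment> \<open>Nonnegativity of the bound is inherited from \<open>f\<close>; it makes the
    passage between extended and real integrals of \<open>w\<close> legitimate.\<close>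
  have w0: "0 \<le> w u" if "u \<in> space MU" for u
    using le[OF that] by (rule order_trans[rotated]) (simp add: nonneg)
  have "(\<integral>\<^sup>+\<omega>. f (U \<omega>, X \<omega>) \<partial>M) = (\<integral>\<^sup>+y. f y \<partial>(distr M MU U \<Otimes>\<^sub>M distr M MX X))"
    unfolding law by (subst nn_integral_distr) auto
  also have "\<dots> = (\<integral>\<^sup>+u. \<integral>\<^sup>+x. f (u, x) \<partial>distr M MX X \<partial>distr M MU U)"
    by (subst X.nn_integral_fst) auto
  also have "\<dots> \<le> (\<integral>\<^sup>+u. w u \<partial>distr M MU U)"
  proof (rule nn_integral_mono)
    fix u assume "u \<in> space (distr M MU U)"
    then have u: "u \<in> space MU" by simp
    show "(\<integral>\<^sup>+x. f (u, x) \<partial>distr M MX X) \<le> ennreal (w u)"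
      using int[OF u] le[OF u] nonneg
      by (subst nn_integral_eq_integral) (auto intro: ennreal_leI)
  qed
  also have "\<dots> = (\<integral>\<^sup>+\<omega>. w (U \<omega>) \<partial>M)"
    by (subst nn_integral_distr) auto
  also have "\<dots> = ennreal (expectation (\<lambda>\<omega>. w (U \<omega>)))"
    using measurable_space[OF \<open>U \<in> M \<rightarrow>\<^sub>M MU\<close>] w0 w
    by (subst nn_integral_eq_integral) auto
  finally have le': "(\<integral>\<^sup>+\<omega>. f (U \<omega>, X \<omega>) \<partial>M) \<le> ennreal (expectation (\<lambda>\<omega>. w (U \<omega>)))" .
  then show int': "integrable M (\<lambda>\<omega>. f (U \<omega>, X \<omega>))"
    using nonneg by (intro integrableI_nonneg) (auto simp: order_le_less_trans)
  have "0 \<le> expectation (\<lambda>\<omega>. w (U \<omega>))"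
    using measurable_space[OF \<open>U \<in> M \<rightarrow>\<^sub>M MU\<close>] w0
    by (intro Bochner_Integration.integral_nonneg_AE AE_I2) auto
  then show "expectation (\<lambda>\<omega>. f (U \<omega>, X \<omega>)) \<le> expectation (\<lambda>\<omega>. w (U \<omega>))"
    using le' nonneg nn_integral_eq_integral[OF int'] by simp
qed

text \<open>The signed counterpart, by Fubini, which is why integrability is assumed here. It makes
  the cross terms in the Monte Carlo variance vanish.\<close>

lemma indep_pair_integral_eq_0:
  fixes f :: "'u \<times> 'x \<Rightarrow> real"
  assumes ind: "indep_pair MU U MX X"
    and [measurable]: "f \<in> borel_measurable (MU \<Otimes>\<^sub>M MX)"
    and int: "integrable M (\<lambda>\<omega>. f (U \<omega>, X \<omega>))"
    and eq0: "\<And>u. u \<in> space MU \<Longrightarrow> (LINT x|distr M MX X. f (u, x)) = 0"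
  shows "expectation (\<lambda>\<omega>. f (U \<omega>, X \<omega>)) = 0"
proof -
  have [measurable]: "U \<in> M \<rightarrow>\<^sub>M MU" "X \<in> M \<rightarrow>\<^sub>M MX"
    and law: "distr M MU U \<Otimes>\<^sub>M distr M MX X = distr M (MU \<Otimes>\<^sub>M MX) (\<lambda>\<omega>. (U \<omega>, X \<omega>))"
    using ind by (auto simp: indep_pair_def)
  interpret U: prob_space "distr M MU U" by (rule prob_space_distr) simp
  interpret X: prob_space "distr M MX X" by (rule prob_space_distr) simp
  interpret UX: pair_sigma_finite "distr M MU U" "distr M MX X" ..
  have "integrable (distr M MU U \<Otimes>\<^sub>M distr M MX X) f"
    unfolding law using int by (subst integrable_distr_eq) auto
  then have "(LINT y|(distr M MU U \<Otimes>\<^sub>M distr M MX X). f y)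
      = (LINT u|distr M MU U. LINT x|distr M MX X. f (u, x))"
    by (rule UX.integral_fst'[symmetric])
  also have "\<dots> = (LINT u|distr M MU U. 0)"
    by (rule Bochner_Integration.integral_cong) (auto simp: eq0)
  also have "(LINT y|(distr M MU U \<Otimes>\<^sub>M distr M MX X). f y) = expectation (\<lambda>\<omega>. f (U \<omega>, X \<omega>))"
    unfolding law by (subst integral_distr) auto
  finally show ?thesis by simp
qed

text \<open>\<open>Z\<close> stands for everything simulated earlier and the \<open>X i\<close> for
  fresh samples. With \<open>Z\<close> frozen, the summands are independent with a common law, so
  the mean square error is variance plus squared bias: the variance is at most the second moment
  \<open>w\<close> divided by the sample size, and the squared bias, measured from the target
  \<open>a\<close>, is at most \<open>v\<close>. Only pairwise independence of the samples given
  \<open>Z\<close> enters, in the form \<open>ind2\<close>.\<close>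

lemma monte_carlo_second_moments:
  fixes F :: "'z \<times> 'x \<Rightarrow> real"
  assumes I: "finite I" "I \<noteq> {}"
    and ind: "\<And>i. i \<in> I \<Longrightarrow> indep_pair MZ Z MX (X i)"
    and ind2: "\<And>i j. i \<in> I \<Longrightarrow> j \<in> I \<Longrightarrow> i \<noteq> j \<Longrightarrow>
      indep_pair (MZ \<Otimes>\<^sub>M MX) (\<lambda>\<omega>. (Z \<omega>, X i \<omega>)) MX (X j)"
    and law: "\<And>i. i \<in> I \<Longrightarrow> distr M MX (X i) = \<mu>"
    and [measurable]: "F \<in> borel_measurable (MZ \<Otimes>\<^sub>M MX)" "w \<in> borel_measurable MZ"
      "v \<in> borel_measurable MZ"
    and sq: "\<And>z. z \<in> space MZ \<Longrightarrow> integrable \<mu> (\<lambda>x. (F (z, x))\<^sup>2)"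
    and sq_le: "\<And>z. z \<in> space MZ \<Longrightarrow> (LINT x|\<mu>. (F (z, x))\<^sup>2) \<le> w z"
    and bias_le: "\<And>z. z \<in> space MZ \<Longrightarrow> ((LINT x|\<mu>. F (z, x)) - a)\<^sup>2 \<le> v z"
    and w: "integrable M (\<lambda>\<omega>. w (Z \<omega>))" and v: "integrable M (\<lambda>\<omega>. v (Z \<omega>))"
  defines "est \<equiv> \<lambda>\<omega>. (\<Sum>i\<in>I. F (Z \<omega>, X i \<omega>)) / real (card I)"
  shows "integrable M (\<lambda>\<omega>. (est \<omega>)\<^sup>2)"
    and "expectation (\<lambda>\<omega>. (est \<omega>)\<^sup>2) \<le> expectation (\<lambda>\<omega>. w (Z \<omega>))"
    and "integrable M (\<lambda>\<omega>. (est \<omega> - a)\<^sup>2)"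
    and "expectation (\<lambda>\<omega>. (est \<omega> - a)\<^sup>2)
      \<le> expectation (\<lambda>\<omega>. w (Z \<omega>)) / real (card I) + expectation (\<lambda>\<omega>. v (Z \<omega>))"
proof -
  define N where "N = real (card I)"
  have N: "0 < N" using I by (simp add: N_def card_gt_0_iff)
  obtain i0 where i0: "i0 \<in> I" using I by blast
  have X[measurable]: "X i \<in> M \<rightarrow>\<^sub>M MX" if "i \<in> I" for i
    using ind[OF that] by (simp add: indep_pair_def)
  have Z[measurable]: "Z \<in> M \<rightarrow>\<^sub>M MZ"
    using ind[OF i0] by (simp add: indep_pair_def)
  have \<mu>_sets[measurable_cong]: "sets \<mu> = sets MX"
    using law[OF i0] by auto
  interpret \<mu>: prob_space \<mu>
    using prob_space_distr[OF X[OF i0]] law[OF i0] by simp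
  have ZX[measurable]: "(\<lambda>\<omega>. (Z \<omega>, X i \<omega>)) \<in> M \<rightarrow>\<^sub>M MZ \<Otimes>\<^sub>M MX" if "i \<in> I" for i
    using that by measurable
  have FX[measurable]: "(\<lambda>\<omega>. F (Z \<omega>, X i \<omega>)) \<in> borel_measurable M" if "i \<in> I" for i
    using measurable_compose[OF ZX[OF that], of F borel] by simp
  have Zsp: "Z \<omega> \<in> space MZ" if "\<omega> \<in> space M" for \<omega>
    using measurable_space[OF Z that] .
  have F1: "integrable \<mu> (\<lambda>x. F (z, x))" if "z \<in> space MZ" for z
    using that by (intro \<mu>.square_integrable_imp_integrable[OF _ sq[OF that]]) measurable
  define G where "G z = (LINT x|\<mu>. F (z, x))" for z
  have [measurable]: "G \<in> borel_measurable MZ"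
    unfolding G_def[abs_def] by (rule \<mu>.borel_measurable_lebesgue_integral) simp
  \<comment> \<open>\<open>G\<close> is the conditional mean given \<open>Z\<close> and
    \<open>D\<close> the centred summand; \<open>D\<close> integrates to 0 over \<open>\<mu>\<close>
    for every frozen \<open>z\<close>.\<close>
  define D where "D y = F y - G (fst y)" for y
  have D[measurable]: "D \<in> borel_measurable (MZ \<Otimes>\<^sub>M MX)"
    unfolding D_def[abs_def] by measurable
  have DX[measurable]: "(\<lambda>\<omega>. D (Z \<omega>, X i \<omega>)) \<in> borel_measurable M" if "i \<in> I" for i
    using measurable_compose[OF ZX[OF that] D] by simp
  have D0: "(LINT x|\<mu>. D (z, x)) = 0" if "z \<in> space MZ" for z
    using F1[OF that] by (simp add: D_def G_def \<mu>.prob_space)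
  have D2: "integrable \<mu> (\<lambda>x. (D (z, x))\<^sup>2)" "(LINT x|\<mu>. (D (z, x))\<^sup>2) \<le> w z"
    if z: "z \<in> space MZ" for z
  proof -
    have eq: "(D (z, x))\<^sup>2 = (F (z, x))\<^sup>2 - 2 * G z * F (z, x) + (G z)\<^sup>2" for x
      by (simp add: D_def power2_diff)
    show "integrable \<mu> (\<lambda>x. (D (z, x))\<^sup>2)"
      unfolding eq using sq[OF z] F1[OF z] by simp
    have "(LINT x|\<mu>. (D (z, x))\<^sup>2) = (LINT x|\<mu>. (F (z, x))\<^sup>2) - (G z)\<^sup>2"
      unfolding eq using sq[OF z] F1[OF z]
      by (simp add: \<mu>.prob_space G_def[symmetric] power2_eq_square)
    also have "\<dots> \<le> w z"
      using sq_le[OF z] zero_le_power2[of "G z"] by linarith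
    finally show "(LINT x|\<mu>. (D (z, x))\<^sup>2) \<le> w z" .
  qed
  have EF: "integrable M (\<lambda>\<omega>. (F (Z \<omega>, X i \<omega>))\<^sup>2)"
    "expectation (\<lambda>\<omega>. (F (Z \<omega>, X i \<omega>))\<^sup>2) \<le> expectation (\<lambda>\<omega>. w (Z \<omega>))" if "i \<in> I" for i
    using that sq sq_le
    by (auto intro!: indep_pair_integral_le[OF ind[OF that], of "\<lambda>y. (F y)\<^sup>2" w] w simp: law)
  have ED: "integrable M (\<lambda>\<omega>. (D (Z \<omega>, X i \<omega>))\<^sup>2)"
    "expectation (\<lambda>\<omega>. (D (Z \<omega>, X i \<omega>))\<^sup>2) \<le> expectation (\<lambda>\<omega>. w (Z \<omega>))" if "i \<in> I" for i
    using that D2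
    by (auto intro!: indep_pair_integral_le[OF ind[OF that], of "\<lambda>y. (D y)\<^sup>2" w] w simp: law)
  have ER: "integrable M (\<lambda>\<omega>. (G (Z \<omega>) - a)\<^sup>2)"
    "expectation (\<lambda>\<omega>. (G (Z \<omega>) - a)\<^sup>2) \<le> expectation (\<lambda>\<omega>. v (Z \<omega>))"
  proof -
    have le: "(G (Z \<omega>) - a)\<^sup>2 \<le> v (Z \<omega>)" if "\<omega> \<in> space M" for \<omega>
      using bias_le[OF Zsp[OF that]] by (simp add: G_def)
    show int: "integrable M (\<lambda>\<omega>. (G (Z \<omega>) - a)\<^sup>2)"
    proof (rule Bochner_Integration.integrable_bound[OF v])
      show "AE \<omega> in M. norm ((G (Z \<omega>) - a)\<^sup>2) \<le> norm (v (Z \<omega>))"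
      proof (rule AE_I2)
        fix \<omega> assume "\<omega> \<in> space M"
        from le[OF this] show "norm ((G (Z \<omega>) - a)\<^sup>2) \<le> norm (v (Z \<omega>))" by simp
      qed
    qed measurable
    show "expectation (\<lambda>\<omega>. (G (Z \<omega>) - a)\<^sup>2) \<le> expectation (\<lambda>\<omega>. v (Z \<omega>))"
      by (rule integral_mono[OF int v le])
  qed
  let ?D = "\<lambda>i \<omega>. D (Z \<omega>, X i \<omega>)" and ?R = "\<lambda>\<omega>. G (Z \<omega>) - a"
  have DD_int: "integrable M (\<lambda>\<omega>. ?D i \<omega> * ?D j \<omega>)" if "i \<in> I" "j \<in> I" for i j
    using that by (intro integrable_mult_L2 ED) auto
  have DR_int: "integrable M (\<lambda>\<omega>. ?R \<omega> * ?D i \<omega>)" if "i \<in> I" for i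
    using that by (intro integrable_mult_L2 ED ER) auto
  \<comment> \<open>Freezing \<open>Z\<close> together with sample \<open>i\<close> leaves sample
    \<open>j\<close> free, and the centred factor of \<open>j\<close> then integrates to 0.\<close>
  have DD: "expectation (\<lambda>\<omega>. ?D i \<omega> * ?D j \<omega>) = 0" if ij: "i \<in> I" "j \<in> I" "i \<noteq> j" for i j
  proof -
    have "expectation (\<lambda>\<omega>. (\<lambda>(y, x). D y * D (fst y, x)) ((Z \<omega>, X i \<omega>), X j \<omega>)) = 0"
    proof (rule indep_pair_integral_eq_0[OF ind2[OF ij]])
      show "(\<lambda>(y, x). D y * D (fst y, x)) \<in> borel_measurable ((MZ \<Otimes>\<^sub>M MX) \<Otimes>\<^sub>M MX)"
        by measurable
      show "integrable M (\<lambda>\<omega>. (\<lambda>(y, x). D y * D (fst y, x)) ((Z \<omega>, X i \<omega>), X j \<omega>))"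
        using DD_int[OF ij(1,2)] by simp
      show "(LINT x|distr M MX (X j). (\<lambda>(y, x). D y * D (fst y, x)) (u, x)) = 0"
        if "u \<in> space (MZ \<Otimes>\<^sub>M MX)" for u
        using D0[of "fst u"] that by (auto simp: law[OF ij(2)] space_pair_measure)
    qed
    then show ?thesis by simp
  qed
  have DR: "expectation (\<lambda>\<omega>. ?R \<omega> * ?D i \<omega>) = 0" if i: "i \<in> I" for i
  proof -
    have "expectation (\<lambda>\<omega>. (\<lambda>(z, x). (G z - a) * D (z, x)) (Z \<omega>, X i \<omega>)) = 0"
    proof (rule indep_pair_integral_eq_0[OF ind[OF i]])
      show "(\<lambda>(z, x). (G z - a) * D (z, x)) \<in> borel_measurable (MZ \<Otimes>\<^sub>M MX)"
        by measurable
      show "integrable M (\<lambda>\<omega>. (\<lambda>(z, x). (G z - a) * D (z, x)) (Z \<omega>, X i \<omega>))"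
        using DR_int[OF i] by simp
      show "(LINT x|distr M MX (X i). (\<lambda>(z, x). (G z - a) * D (z, x)) (u, x)) = 0"
        if "u \<in> space MZ" for u
        using D0[OF that] by (auto simp: law[OF i])
    qed
    then show ?thesis by simp
  qed
  \<comment> \<open>Centred average plus conditional bias.\<close>
  have est_R: "est \<omega> - a = (\<Sum>i\<in>I. ?D i \<omega>) / N + ?R \<omega>" for \<omega>
    using N by (simp add: est_def D_def sum_subtractf N_def[symmetric] field_simps)
  have est_sq: "(est \<omega> - a)\<^sup>2
      = (\<Sum>i\<in>I. \<Sum>j\<in>I. ?D i \<omega> * ?D j \<omega>) / N\<^sup>2 + 2 / N * (\<Sum>i\<in>I. ?R \<omega> * ?D i \<omega>) + (?R \<omega>)\<^sup>2" for \<omega>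
  proof -
    have "(\<Sum>i\<in>I. \<Sum>j\<in>I. ?D i \<omega> * ?D j \<omega>) = (\<Sum>i\<in>I. ?D i \<omega>)\<^sup>2"
      by (simp add: power2_eq_square sum_product)
    moreover have "(\<Sum>i\<in>I. ?R \<omega> * ?D i \<omega>) = ?R \<omega> * (\<Sum>i\<in>I. ?D i \<omega>)"
      by (simp add: sum_distrib_left)
    ultimately show ?thesis
      unfolding est_R by (simp add: power2_sum power_divide)
  qed
  show int: "integrable M (\<lambda>\<omega>. (est \<omega> - a)\<^sup>2)"
    unfolding est_sq using DD_int DR_int ER
    by (intro Bochner_Integration.integrable_add integrable_divide_zero integrable_mult_right
        Bochner_Integration.integrable_sum) auto
  have "expectation (\<lambda>\<omega>. (est \<omega> - a)\<^sup>2)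
      = (\<Sum>i\<in>I. \<Sum>j\<in>I. expectation (\<lambda>\<omega>. ?D i \<omega> * ?D j \<omega>)) / N\<^sup>2
        + 2 / N * (\<Sum>i\<in>I. expectation (\<lambda>\<omega>. ?R \<omega> * ?D i \<omega>)) + expectation (\<lambda>\<omega>. (?R \<omega>)\<^sup>2)"
    unfolding est_sq using DD_int DR_int ER(1)
    by (simp add: Bochner_Integration.integral_sum Bochner_Integration.integrable_sum)
  also have "(\<Sum>i\<in>I. \<Sum>j\<in>I. expectation (\<lambda>\<omega>. ?D i \<omega> * ?D j \<omega>))
      = (\<Sum>i\<in>I. expectation (\<lambda>\<omega>. (?D i \<omega>)\<^sup>2))"
  proof (rule sum.cong[OF refl])
    fix i assume i: "i \<in> I"
    have "(\<Sum>j\<in>I. expectation (\<lambda>\<omega>. ?D i \<omega> * ?D j \<omega>))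
        = (\<Sum>j\<in>I. if j = i then expectation (\<lambda>\<omega>. (?D i \<omega>)\<^sup>2) else 0)"
      using DD[OF i] by (intro sum.cong) (auto simp: power2_eq_square)
    then show "(\<Sum>j\<in>I. expectation (\<lambda>\<omega>. ?D i \<omega> * ?D j \<omega>)) = expectation (\<lambda>\<omega>. (?D i \<omega>)\<^sup>2)"
      using i I(1) by simp
  qed
  also have "(\<Sum>i\<in>I. expectation (\<lambda>\<omega>. ?R \<omega> * ?D i \<omega>)) = 0"
    by (simp add: DR)
  \<comment> \<open>Only the diagonal survives: \<open>N\<close> terms over
    \<open>N\<^sup>2\<close>, the source of the factor \<open>1 / N\<close>.\<close>
  also have "(\<Sum>i\<in>I. expectation (\<lambda>\<omega>. (?D i \<omega>)\<^sup>2)) / N\<^sup>2 + 2 / N * 0 + expectation (\<lambda>\<omega>. (?R \<omega>)\<^sup>2)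
      \<le> (N * expectation (\<lambda>\<omega>. w (Z \<omega>))) / N\<^sup>2 + 2 / N * 0 + expectation (\<lambda>\<omega>. v (Z \<omega>))"
  proof (intro add_mono divide_right_mono)
    show "(\<Sum>i\<in>I. expectation (\<lambda>\<omega>. (?D i \<omega>)\<^sup>2)) \<le> N * expectation (\<lambda>\<omega>. w (Z \<omega>))"
      using sum_mono[OF ED(2), of I "\<lambda>i. i"] by (simp add: N_def)
  qed (use ER(2) in auto)
  also have "\<dots> = expectation (\<lambda>\<omega>. w (Z \<omega>)) / N + expectation (\<lambda>\<omega>. v (Z \<omega>))"
    using N by (simp add: power2_eq_square)
  finally show "expectation (\<lambda>\<omega>. (est \<omega> - a)\<^sup>2)
      \<le> expectation (\<lambda>\<omega>. w (Z \<omega>)) / real (card I) + expectation (\<lambda>\<omega>. v (Z \<omega>))"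
    by (simp add: N_def)
  \<comment> \<open>The plain second moment needs no variance computation: the square of an average
    is at most the average of the squares.\<close>
  have "(est \<omega>)\<^sup>2 \<le> (\<Sum>i\<in>I. (F (Z \<omega>, X i \<omega>))\<^sup>2) / N" for \<omega>
  proof -
    have "(\<Sum>i\<in>I. F (Z \<omega>, X i \<omega>))\<^sup>2 \<le> N * (\<Sum>i\<in>I. (F (Z \<omega>, X i \<omega>))\<^sup>2)"
      using Cauchy_Schwarz_ineq_sum[of "\<lambda>_. 1" "\<lambda>i. F (Z \<omega>, X i \<omega>)" I] by (simp add: N_def)
    then show ?thesis
      using N by (simp add: est_def N_def[symmetric] field_simps power2_eq_square)
  qed
  note le = this
  have FI: "integrable M (\<lambda>\<omega>. (\<Sum>i\<in>I. (F (Z \<omega>, X i \<omega>))\<^sup>2) / N)"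
    using EF by (intro integrable_divide_zero Bochner_Integration.integrable_sum) auto
  show int': "integrable M (\<lambda>\<omega>. (est \<omega>)\<^sup>2)"
  proof (rule Bochner_Integration.integrable_bound[OF FI])
    show "(\<lambda>\<omega>. (est \<omega>)\<^sup>2) \<in> borel_measurable M"
      unfolding est_def by measurable
    show "AE \<omega> in M. norm ((est \<omega>)\<^sup>2) \<le> norm ((\<Sum>i\<in>I. (F (Z \<omega>, X i \<omega>))\<^sup>2) / N)"
      using N by (auto intro!: AE_I2 order_trans[OF le] divide_right_mono)
  qed
  have "expectation (\<lambda>\<omega>. (est \<omega>)\<^sup>2) \<le> expectation (\<lambda>\<omega>. (\<Sum>i\<in>I. (F (Z \<omega>, X i \<omega>))\<^sup>2) / N)"
    by (rule integral_mono[OF int' FI le])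
  also have "\<dots> = (\<Sum>i\<in>I. expectation (\<lambda>\<omega>. (F (Z \<omega>, X i \<omega>))\<^sup>2)) / N"
    using EF by (simp add: Bochner_Integration.integral_sum)
  also have "\<dots> \<le> (N * expectation (\<lambda>\<omega>. w (Z \<omega>))) / N"
    using sum_mono[OF EF(2), of I "\<lambda>i. i"] N by (intro divide_right_mono) (auto simp: N_def)
  finally show "expectation (\<lambda>\<omega>. (est \<omega>)\<^sup>2) \<le> expectation (\<lambda>\<omega>. w (Z \<omega>))"
    using N by simp
qed

text \<open>Grouping an independent family into blocks yields product spaces on both sides, so
  \<open>b\<close> first appears as a block with one index; projecting that block to its only
  coordinate gives the statement.\<close>

lemma indep_vars_indep_pair:
  assumes ind: "indep_vars M' X I" and A: "A \<subseteq> I" "b \<in> I" "b \<notin> A"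
  shows "indep_pair (PiM A M') (\<lambda>\<omega>. \<lambda>i\<in>A. X i \<omega>) (M' b) (X b)"
proof -
  have "indep_var (PiM A M') (\<lambda>\<omega>. \<lambda>i\<in>A. X i \<omega>) (PiM {b} M') (\<lambda>\<omega>. \<lambda>i\<in>{b}. X i \<omega>)"
    using A by (intro indep_var_restrict[OF ind]) auto
  then have "indep_pair (PiM A M') (\<lambda>\<omega>. \<lambda>i\<in>A. X i \<omega>) (PiM {b} M') (\<lambda>\<omega>. \<lambda>i\<in>{b}. X i \<omega>)"
    by (simp add: indep_var_distribution_eq indep_pair_def)
  from indep_pair_compose[OF this measurable_ident_sets[OF refl]
      measurable_component_singleton[of b "{b}" M']]
  show ?thesis by simp
qed

end

section \<open>Regression coefficients\<close>

lemma frobenius_norm_sq: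
  assumes "A \<in> carrier_mat (K + 1) (K + 1)"
  shows "(frobenius_norm A)\<^sup>2 = (\<Sum>i\<le>K. \<Sum>j\<le>K. (A $$ (i, j))\<^sup>2)"
  using assms by (simp add: frobenius_norm_def sum_nonneg lessThan_Suc_atMost)

text \<open>Cauchy-Schwarz row by row: the Frobenius norm dominates the operator norm.\<close>

lemma sum_sq_matrix_le:
  fixes P :: "nat \<Rightarrow> nat \<Rightarrow> real"
  shows "(\<Sum>i\<le>K. (\<Sum>j\<le>K. P i j * d j)\<^sup>2) \<le> (\<Sum>i\<le>K. \<Sum>j\<le>K. (P i j)\<^sup>2) * (\<Sum>j\<le>K. (d j)\<^sup>2)"
  unfolding sum_distrib_right by (intro sum_mono Cauchy_Schwarz_ineq_sum[unfolded sum_distrib_right])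

text \<open>\<open>mat_inverse\<close> is specified through the units of the matrix ring, so
  invertibility is first turned into membership in \<open>Units\<close>; this excludes the result
  \<open>None\<close>.\<close>

lemma mat_inv_right:
  assumes A: "A \<in> carrier_mat k k" and inv: "invertible_mat A"
  shows "mat_inv A \<in> carrier_mat k k" and "A * mat_inv A = 1\<^sub>m k"
proof -
  obtain B where B: "A * B = 1\<^sub>m k" "B * A = 1\<^sub>m k" "B \<in> carrier_mat k k"
    using inv A unfolding invertible_mat_def inverts_mat_def
    by (metis carrier_matD carrier_matI index_mult_mat(2,3) index_one_mat(2,3))
  then have "A \<in> Units (ring_mat TYPE(real) k ())"
    using A unfolding Units_def ring_mat_def by auto
  then obtain C where "mat_inverse A = Some C"
    using mat_inverse(1)[OF A, of "()"] by (cases "mat_inverse A") auto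
  then show "mat_inv A \<in> carrier_mat k k" "A * mat_inv A = 1\<^sub>m k"
    using mat_inverse(2)[OF A, of C] by (auto simp: mat_inv_def)
qed

text \<open>Since \<open>A\<close> is at least 1, the inhomogeneous term \<open>A\<close> is at most
  \<open>A ^ Suc j\<close>; each step therefore adds one to the linear factor.\<close>

lemma second_moment_recursion:
  fixes A W W' :: real
  assumes "1 \<le> A" "W \<le> A + A * W'" "W' \<le> real j * A ^ j"
  shows "W \<le> real (Suc j) * A ^ Suc j"
proof -
  have "A * W' \<le> A * (real j * A ^ j)" using assms by (intro mult_left_mono) auto
  moreover have "A * 1 \<le> A * A ^ j" using assms by (intro mult_left_mono one_le_power) auto
  ultimately have "W \<le> A * A ^ j + A * (real j * A ^ j)" using assms by linarith
  then show ?thesis by (simp add: algebra_simps)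
qed

text \<open>The linear factor of the second moments is absorbed by the doubling:
  \<open>Suc j \<le> 2 ^ j \<le> 2 ^ j * s\<close>, and adding \<open>(2 ^ j - 1) * s\<close> gives
  \<open>(2 ^ Suc j - 1) * s\<close>.\<close>

lemma error_recursion:
  fixes A D D' W N s :: real
  assumes "1 \<le> A" "0 < N" "1 \<le> s" "D \<le> W / N + A * D'" "W \<le> real (Suc j) * A ^ Suc j"
    and "D' \<le> (2 ^ j - 1) * s * A ^ j / N"
  shows "D \<le> (2 ^ Suc j - 1) * s * A ^ Suc j / N"
proof -
  have "real (Suc j) \<le> 2 ^ j"
    using of_nat_mono[OF Suc_leI[OF less_exp[of j]], where 'a = real] by simp
  then have "real (Suc j) * 1 \<le> 2 ^ j * s"
    using assms by (intro mult_mono) auto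
  then have "real (Suc j) + (2 ^ j - 1) * s \<le> (2 ^ Suc j - 1) * s"
    by (simp add: algebra_simps)
  then have *: "(real (Suc j) + (2 ^ j - 1) * s) * (A ^ Suc j / N) \<le> (2 ^ Suc j - 1) * s * (A ^ Suc j / N)"
    using assms by (intro mult_right_mono) auto
  have "W / N \<le> real (Suc j) * A ^ Suc j / N"
    using assms by (intro divide_right_mono) auto
  moreover have "A * D' \<le> A * ((2 ^ j - 1) * s * A ^ j / N)"
    using assms by (intro mult_left_mono) auto
  ultimately have "D \<le> real (Suc j) * A ^ Suc j / N + A * ((2 ^ j - 1) * s * A ^ j / N)"
    using assms by linarith
  also have "\<dots> = (real (Suc j) + (2 ^ j - 1) * s) * (A ^ Suc j / N)"
    using assms(2) by (simp add: field_simps)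
  finally show ?thesis using * by simp
qed

section \<open>The pricing model for one fixed number of basis functions\<close>

locale regression_pricing = prob_space M
  for M :: "'w measure" +
  fixes S :: "real \<Rightarrow> 'w \<Rightarrow> 'a::euclidean_space"
    and t :: "nat \<Rightarrow> real" and m :: nat
    and h :: "nat \<Rightarrow> 'a \<Rightarrow> real" and \<psi> :: "nat \<Rightarrow> nat \<Rightarrow> 'a \<Rightarrow> real" and K :: nat
  assumes m_ge_2: "2 \<le> m" and t_0: "t 0 = 0" and t_mono: "strict_mono_on {..m} t"
    and S_measurable: "\<And>n. n \<in> {1..m} \<Longrightarrow> S (t n) \<in> borel_measurable M"
    and payoff_measurable: "\<And>n. n \<le> m \<Longrightarrow> h n \<in> borel_measurable borel"
    and basis_measurable: "\<And>n k. n \<in> {1..m} \<Longrightarrow> \<psi> n k \<in> borel_measurable borel"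
    and finite_basis: "\<And>n k. n \<in> {1..m} \<Longrightarrow> integrable M (\<lambda>\<omega>. (\<psi> n k (S (t n) \<omega>)) ^ 4)"
    and finite_payoff: "\<And>n. n \<in> {2..m} \<Longrightarrow> integrable M (\<lambda>\<omega>. (h n (S (t n) \<omega>)) ^ 4)"
    and A0_const: "\<And>n x. n \<in> {1..m} \<Longrightarrow> \<psi> n 0 x = 1"
    and A0_mean: "\<And>n k. n \<in> {1..m} \<Longrightarrow> 1 \<le> k \<Longrightarrow> (LINT \<omega>|M. \<psi> n k (S (t n) \<omega>)) = 0"
    and A0_nonsingular: "\<And>n. n \<in> {1..m} \<Longrightarrow> invertible_mat (gram M S t \<psi> K n)"
    and B1: "\<And>p n n' k k'. p \<in> {2, 4} \<Longrightarrow> 1 \<le> n \<Longrightarrow> n \<le> n' \<Longrightarrow> n' \<le> m \<Longrightarrow> k \<le> k' \<Longrightarrow>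
      (LINT \<omega>|M. (\<psi> n k (S (t n) \<omega>)) ^ p) \<le> (LINT \<omega>|M. (\<psi> n' k' (S (t n') \<omega>)) ^ p)"
    and B3: "\<And>n. n \<in> {2..m} \<Longrightarrow> (LINT \<omega>|M. (h n (S (t n) \<omega>)) ^ 4)
      \<le> (t n / t (n - 1)) ^ (2 * K) * (LINT \<omega>|M. (\<psi> n K (S (t n) \<omega>)) ^ 4)"
begin

section \<open>Moment bounds, the inverse Gram matrix and the constants\<close>

definition "q = (LINT \<omega>|M. (\<psi> m K (S (t m) \<omega>)) ^ 4)"
definition "p = (LINT \<omega>|M. (\<psi> m K (S (t m) \<omega>))\<^sup>2)"
abbreviation "c \<equiv> const_c t m"
abbreviation "B \<equiv> const_B M S t m \<psi> K"
abbreviation "H \<equiv> const_H M S t m \<psi> K"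
abbreviation "A \<equiv> const_A M S t m \<psi> K"
abbreviation "P n \<equiv> mat_inv (gram M S t \<psi> K n)"

lemma psi_S_measurable [measurable]:
  "n \<in> {1..m} \<Longrightarrow> (\<lambda>\<omega>. \<psi> n k (S (t n) \<omega>)) \<in> borel_measurable M"
  using measurable_compose[OF S_measurable basis_measurable] by simp

lemma payoff_S_measurable [measurable]:
  "n \<in> {1..m} \<Longrightarrow> (\<lambda>\<omega>. h n (S (t n) \<omega>)) \<in> borel_measurable M"
  using measurable_compose[OF S_measurable payoff_measurable] by simp

lemma psi_S_sq_integrable: "n \<in> {1..m} \<Longrightarrow> integrable M (\<lambda>\<omega>. (\<psi> n k (S (t n) \<omega>))\<^sup>2)"
  using square_integrable_imp_integrable[of "\<lambda>\<omega>. (\<psi> n k (S (t n) \<omega>))\<^sup>2"] finite_basis[of n k]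
  by simp

lemma psi_S_mult_integrable:
  "n \<in> {1..m} \<Longrightarrow> integrable M (\<lambda>\<omega>. \<psi> n j (S (t n) \<omega>) * \<psi> n k (S (t n) \<omega>))"
  by (intro integrable_mult_L2 psi_S_sq_integrable) auto

lemma psi_sq_le_p: "n \<in> {1..m} \<Longrightarrow> k \<le> K \<Longrightarrow> (LINT \<omega>|M. (\<psi> n k (S (t n) \<omega>))\<^sup>2) \<le> p"
  using B1[of 2 n m k K] by (simp add: p_def)

lemma psi_4_le_q: "n \<in> {1..m} \<Longrightarrow> k \<le> K \<Longrightarrow> (LINT \<omega>|M. (\<psi> n k (S (t n) \<omega>)) ^ 4) \<le> q"
  using B1[of 4 n m k K] by (simp add: q_def)

text \<open>The basis function of index 0 is constant 1, and the monotonicity in B1 carries its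
  second moment 1 up to index \<open>K\<close>.\<close>

lemma p_ge_1: "1 \<le> p"
  using psi_sq_le_p[of m 0] A0_const m_ge_2 by (simp add: prob_space)

text \<open>Cauchy-Schwarz against the constant 1.\<close>

lemma q_ge_p_sq: "p\<^sup>2 \<le> q"
proof -
  have "(LINT \<omega>|M. 1 * (\<psi> m K (S (t m) \<omega>))\<^sup>2)\<^sup>2
      \<le> (LINT \<omega>|M. 1\<^sup>2) * (LINT \<omega>|M. ((\<psi> m K (S (t m) \<omega>))\<^sup>2)\<^sup>2)"
    using m_ge_2 finite_basis[of m K] by (intro integral_Cauchy_Schwarz) auto
  then show ?thesis by (simp add: prob_space p_def q_def)
qed

lemma q_ge_1: "1 \<le> q"
  using q_ge_p_sq p_ge_1 one_le_power[OF p_ge_1, of 2] by linarith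

lemma c_ge:
  assumes "n \<in> {1..m - 1}"
  shows "0 \<le> t (n + 1) / t n" "t (n + 1) / t n \<le> c"
proof -
  show "t (n + 1) / t n \<le> c"
    unfolding const_c_def using assms by (intro Max_ge) auto
  have "t 0 < t n" "t 0 < t (n + 1)"
    using assms by (auto intro!: strict_mono_onD[OF t_mono])
  then show "0 \<le> t (n + 1) / t n" by (simp add: t_0)
qed

lemma c_nonneg: "0 \<le> c"
proof -
  have "1 \<in> {1..m - 1}" using m_ge_2 by simp
  then show ?thesis using order_trans[OF c_ge] by blast
qed

lemma gram_carrier: "gram M S t \<psi> K n \<in> carrier_mat (K + 1) (K + 1)"
  by (simp add: gram_def)

lemma P_carrier: "n \<in> {1..m} \<Longrightarrow> P n \<in> carrier_mat (K + 1) (K + 1)"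
  using mat_inv_right(1)[OF gram_carrier A0_nonsingular] .

text \<open>The identity between the Gram matrix and its inverse, spelled out as sums of
  expectations; this form can be substituted into quadratic forms of the basis functions.\<close>

lemma gram_P:
  assumes n: "n \<in> {1..m}" and ij: "i \<le> K" "j \<le> K"
  shows "(\<Sum>k\<le>K. (LINT \<omega>|M. \<psi> n i (S (t n) \<omega>) * \<psi> n k (S (t n) \<omega>)) * P n $$ (k, j))
    = (if i = j then 1 else 0)"
proof -
  have "(gram M S t \<psi> K n * P n) $$ (i, j) = (if i = j then 1 else 0)"
    using mat_inv_right(2)[OF gram_carrier A0_nonsingular[OF n]] ij by simp
  moreover have "(gram M S t \<psi> K n * P n) $$ (i, j)
      = (\<Sum>k<K + 1. gram M S t \<psi> K n $$ (i, k) * P n $$ (k, j))"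
    using ij gram_carrier[of n] P_carrier[OF n]
    by (simp add: times_mat_def scalar_prod_def atLeast0LessThan del: sum.lessThan_Suc)
  ultimately show ?thesis
    using ij by (simp add: gram_def lessThan_Suc_atMost del: sum.lessThan_Suc)
qed

lemma frobenius_P_le_B: "n \<in> {1..m - 1} \<Longrightarrow> frobenius_norm (P n) \<le> B"
  unfolding const_B_def by (intro Max_ge) auto

lemma P_sum_sq_le:
  assumes "n \<in> {1..m - 1}"
  shows "(\<Sum>i\<le>K. \<Sum>j\<le>K. (P n $$ (i, j))\<^sup>2) \<le> B\<^sup>2"
proof -
  have "0 \<le> frobenius_norm (P n)" by (simp add: frobenius_norm_def sum_nonneg)
  then have "(frobenius_norm (P n))\<^sup>2 \<le> B\<^sup>2"
    using frobenius_P_le_B[OF assms] by (intro power_mono)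
  then show ?thesis
    using assms by (subst (asm) frobenius_norm_sq[OF P_carrier]) auto
qed

text \<open>The first row of the Gram matrix is the first unit vector, so its inverse has entry 1 in
  the corner.\<close>

lemma B_ge_1: "1 \<le> B"
proof -
  have n: "1 \<in> {1..m}" "1 \<in> {1..m - 1}" using m_ge_2 by auto
  have "(LINT \<omega>|M. \<psi> 1 0 (S (t 1) \<omega>) * \<psi> 1 k (S (t 1) \<omega>)) = (if k = 0 then 1 else 0)" for k
    using A0_const[OF n(1)] A0_mean[OF n(1), of k] by (auto simp: prob_space)
  then have "(\<Sum>k\<le>K. (if k = 0 then 1 else 0) * P 1 $$ (k, 0)) = 1"
    using gram_P[OF n(1), of 0 0] by simp
  then have P00: "P 1 $$ (0, 0) = 1"
    by (simp add: if_distrib[of "\<lambda>x. x * _"] cong: if_cong)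
  have "(P 1 $$ (0, 0))\<^sup>2 \<le> (\<Sum>j\<le>K. (P 1 $$ (0, j))\<^sup>2)"
    by (rule member_le_sum) auto
  also have "\<dots> \<le> (\<Sum>i\<le>K. \<Sum>j\<le>K. (P 1 $$ (i, j))\<^sup>2)"
    by (rule member_le_sum[of 0 "{..K}" "\<lambda>i. \<Sum>j\<le>K. (P 1 $$ (i, j))\<^sup>2"]) (auto intro: sum_nonneg)
  also have "\<dots> \<le> B\<^sup>2" by (rule P_sum_sq_le[OF n(2)])
  finally have "1 \<le> B\<^sup>2" using P00 by simp
  moreover have "0 \<le> B"
    using frobenius_P_le_B[OF n(2)] by (rule order_trans[rotated]) (simp add: frobenius_norm_def sum_nonneg)
  ultimately show ?thesis by (simp add: power2_le_imp_le[of 1 B])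
qed

lemma A_eq: "A = (real K + 1) * H * q"
  by (simp add: const_A_def q_def)

text \<open>The coefficients of the two recursions, each compared with \<open>A\<close>. The two
  arguments of the maximum in \<open>H\<close> give the first two bounds. The third reduces to the
  second through \<open>p \<le> p\<^sup>2 \<le> q\<close> and \<open>B \<le> B\<^sup>2\<close>, and
  it yields \<open>1 \<le> A\<close> because \<open>p\<close> and \<open>B\<close> are at least
  1.\<close>

lemma A_bounds:
  shows "(real K + 1) * (c ^ K * q) \<le> A" "(real K + 1)\<^sup>2 * (q * B\<^sup>2) \<le> A"
    "(real K + 1) * (p * B) \<le> A" "1 \<le> A"
proof -
  have q: "0 \<le> q" using q_ge_1 by linarith
  have "c ^ K * q \<le> H * q" using q by (intro mult_right_mono) (simp_all add: const_H_def)
  then show "(real K + 1) * (c ^ K * q) \<le> A"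
    by (simp add: A_eq mult.assoc)
  have "B\<^sup>2 * (real K + 1) * q \<le> H * q" using q by (intro mult_right_mono) (simp_all add: const_H_def)
  then have "(real K + 1) * (B\<^sup>2 * (real K + 1) * q) \<le> (real K + 1) * (H * q)"
    by (intro mult_left_mono) auto
  then show *: "(real K + 1)\<^sup>2 * (q * B\<^sup>2) \<le> A"
    by (simp add: A_eq power2_eq_square mult_ac)
  have "p * B \<le> q * B\<^sup>2"
  proof (rule mult_mono)
    have "p * 1 \<le> p * p" using p_ge_1 by (intro mult_left_mono) auto
    then show "p \<le> q" using q_ge_p_sq by (simp add: power2_eq_square)
    show "B \<le> B\<^sup>2" using B_ge_1 by (simp add: power2_eq_square)
  qed (use q B_ge_1 in auto)
  then have "(real K + 1) * (p * B) \<le> (real K + 1)\<^sup>2 * (q * B\<^sup>2)"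
    using p_ge_1 B_ge_1 self_le_power[of "real K + 1" 2] \<open>p * B \<le> q * B\<^sup>2\<close>
    by - (rule mult_mono, auto)
  then show pB: "(real K + 1) * (p * B) \<le> A" using * by linarith
  have "1 * (1 * 1) \<le> (real K + 1) * (p * B)"
    using p_ge_1 B_ge_1 by (intro mult_mono) simp_all
  then show "1 \<le> A" using pB by linarith
qed

lemma P_coef_sq_le:
  assumes "n \<in> {1..m - 1}"
  shows "(\<Sum>i\<le>K. (\<Sum>j\<le>K. P n $$ (i, j) * d j)\<^sup>2) \<le> B\<^sup>2 * (\<Sum>j\<le>K. (d j)\<^sup>2)"
  by (rule order_trans[OF sum_sq_matrix_le[of "\<lambda>i j. P n $$ (i, j)" d K]])
    (intro mult_right_mono P_sum_sq_le assms sum_nonneg zero_le_power2)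

section \<open>Quadratic forms of the basis functions\<close>

lemma combination_sq:
  assumes n: "n \<in> {1..m}"
  shows "integrable M (\<lambda>\<omega>. (\<Sum>k\<le>K. b k * \<psi> n k (S (t n) \<omega>))\<^sup>2)"
    and "(LINT \<omega>|M. (\<Sum>k\<le>K. b k * \<psi> n k (S (t n) \<omega>))\<^sup>2)
      = (\<Sum>i\<le>K. b i * (\<Sum>j\<le>K. (LINT \<omega>|M. \<psi> n i (S (t n) \<omega>) * \<psi> n j (S (t n) \<omega>)) * b j))"
proof -
  have eq: "(\<Sum>k\<le>K. b k * \<psi> n k (S (t n) \<omega>))\<^sup>2
      = (\<Sum>i\<le>K. \<Sum>j\<le>K. (b i * b j) * (\<psi> n i (S (t n) \<omega>) * \<psi> n j (S (t n) \<omega>)))" for \<omega>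
    by (simp add: power2_eq_square sum_product mult_ac)
  show "integrable M (\<lambda>\<omega>. (\<Sum>k\<le>K. b k * \<psi> n k (S (t n) \<omega>))\<^sup>2)"
    unfolding eq by (intro Bochner_Integration.integrable_sum integrable_mult_right
        psi_S_mult_integrable n)
  show "(LINT \<omega>|M. (\<Sum>k\<le>K. b k * \<psi> n k (S (t n) \<omega>))\<^sup>2)
      = (\<Sum>i\<le>K. b i * (\<Sum>j\<le>K. (LINT \<omega>|M. \<psi> n i (S (t n) \<omega>) * \<psi> n j (S (t n) \<omega>)) * b j))"
    unfolding eq
    by (simp add: Bochner_Integration.integral_sum Bochner_Integration.integrable_sum
        psi_S_mult_integrable[OF n] sum_distrib_left mult_ac)
qed

text \<open>With coefficients \<open>b = P d\<close>, the Gram matrix in the quadratic form cancels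
  one of the two inverses and leaves the inner product of \<open>b\<close> and \<open>d\<close>.
  Hence only one factor \<open>B\<close> appears, and no norm of the Gram matrix.\<close>

lemma combination_P_sq:
  assumes n: "n \<in> {1..m - 1}"
  shows "(LINT \<omega>|M. (\<Sum>k\<le>K. (\<Sum>j\<le>K. P n $$ (k, j) * d j) * \<psi> n k (S (t n) \<omega>))\<^sup>2)
      = (\<Sum>i\<le>K. (\<Sum>j\<le>K. P n $$ (i, j) * d j) * d i)"
    and "(\<Sum>i\<le>K. (\<Sum>j\<le>K. P n $$ (i, j) * d j) * d i) \<le> B * (\<Sum>i\<le>K. (d i)\<^sup>2)"
proof -
  have n': "n \<in> {1..m}" using n by auto
  define b where "b k = (\<Sum>j\<le>K. P n $$ (k, j) * d j)" for k
  have "(\<Sum>j\<le>K. (LINT \<omega>|M. \<psi> n i (S (t n) \<omega>) * \<psi> n j (S (t n) \<omega>)) * b j) = d i" if i: "i \<le> K" for i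
  proof -
    have "(\<Sum>j\<le>K. (LINT \<omega>|M. \<psi> n i (S (t n) \<omega>) * \<psi> n j (S (t n) \<omega>)) * b j)
        = (\<Sum>l\<le>K. (\<Sum>j\<le>K. (LINT \<omega>|M. \<psi> n i (S (t n) \<omega>) * \<psi> n j (S (t n) \<omega>)) * P n $$ (j, l)) * d l)"
      unfolding b_def sum_distrib_left sum_distrib_right
      by (subst sum.swap) (simp add: mult.assoc)
    also have "\<dots> = (\<Sum>l\<le>K. (if i = l then 1 else 0) * d l)"
      by (intro sum.cong refl) (simp add: gram_P[OF n' i])
    also have "\<dots> = d i" using i by (simp add: if_distrib[of "\<lambda>x. x * _"] cong: if_cong)
    finally show ?thesis .
  qed
  then show "(LINT \<omega>|M. (\<Sum>k\<le>K. (\<Sum>j\<le>K. P n $$ (k, j) * d j) * \<psi> n k (S (t n) \<omega>))\<^sup>2)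
      = (\<Sum>i\<le>K. (\<Sum>j\<le>K. P n $$ (i, j) * d j) * d i)"
    using combination_sq(2)[OF n', of b] by (simp add: b_def)
  \<comment> \<open>The bound is proved for squares, so that Cauchy-Schwarz and the estimate of the
    coefficients by \<open>B\<^sup>2\<close> apply without roots.\<close>
  have "(\<Sum>i\<le>K. b i * d i)\<^sup>2 \<le> (\<Sum>i\<le>K. (b i)\<^sup>2) * (\<Sum>i\<le>K. (d i)\<^sup>2)"
    by (rule Cauchy_Schwarz_ineq_sum)
  also have "\<dots> \<le> (B\<^sup>2 * (\<Sum>i\<le>K. (d i)\<^sup>2)) * (\<Sum>i\<le>K. (d i)\<^sup>2)"
    unfolding b_def by (intro mult_right_mono P_coef_sq_le n sum_nonneg zero_le_power2)
  also have "\<dots> = (B * (\<Sum>i\<le>K. (d i)\<^sup>2))\<^sup>2"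
    by (simp add: power2_eq_square)
  finally show "(\<Sum>i\<le>K. (\<Sum>j\<le>K. P n $$ (i, j) * d j) * d i) \<le> B * (\<Sum>i\<le>K. (d i)\<^sup>2)"
    unfolding b_def[symmetric] using B_ge_1
    by - (rule power2_le_imp_le, auto intro!: mult_nonneg_nonneg sum_nonneg)
qed

section \<open>Second moments and Lipschitz dependence of the regression targets\<close>

lemma sq_mult_sq_le:
  assumes [measurable]: "f \<in> borel_measurable M" "g \<in> borel_measurable M"
    and f: "integrable M (\<lambda>\<omega>. f \<omega> ^ 4)" "expectation (\<lambda>\<omega>. f \<omega> ^ 4) \<le> a\<^sup>2 * q"
    and g: "integrable M (\<lambda>\<omega>. g \<omega> ^ 4)" "expectation (\<lambda>\<omega>. g \<omega> ^ 4) \<le> q"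
    and a: "0 \<le> a"
  shows "integrable M (\<lambda>\<omega>. (f \<omega>)\<^sup>2 * (g \<omega>)\<^sup>2)" "expectation (\<lambda>\<omega>. (f \<omega>)\<^sup>2 * (g \<omega>)\<^sup>2) \<le> a * q"
proof -
  show "integrable M (\<lambda>\<omega>. (f \<omega>)\<^sup>2 * (g \<omega>)\<^sup>2)"
    using f g by (intro integrable_mult_L2) auto
  have "(expectation (\<lambda>\<omega>. (f \<omega>)\<^sup>2 * (g \<omega>)\<^sup>2))\<^sup>2
      \<le> expectation (\<lambda>\<omega>. ((f \<omega>)\<^sup>2)\<^sup>2) * expectation (\<lambda>\<omega>. ((g \<omega>)\<^sup>2)\<^sup>2)"
    using f g by (intro integral_Cauchy_Schwarz) auto
  also have "\<dots> \<le> (a\<^sup>2 * q) * q"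
    using f g q_ge_1 by (intro mult_mono) auto
  \<comment> \<open>The scaling \<open>a\<^sup>2 * q\<close> of the fourth moment of
    \<open>f\<close> makes this a perfect square. It is applied with \<open>a = c ^ K\<close> to
    payoffs, matching the exponent \<open>2 * K\<close> in B3, and with \<open>a = 1\<close> to
    basis functions.\<close>
  also have "\<dots> = (a * q)\<^sup>2" by (simp add: power2_eq_square)
  finally show "expectation (\<lambda>\<omega>. (f \<omega>)\<^sup>2 * (g \<omega>)\<^sup>2) \<le> a * q"
    using a q_ge_1 by - (rule power2_le_imp_le, auto)
qed

text \<open>The value function as a function of the coefficient vector: exact and estimated values
  are the same map at different coefficients. Vectors are functions on all naturals, of which only
  the entries up to \<open>K\<close> are read.\<close>

definition val :: "nat \<Rightarrow> (nat \<Rightarrow> real) \<Rightarrow> 'a \<Rightarrow> real" where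
  "val n b x = max (h n x) (\<Sum>k\<le>K. b k * \<psi> n k x)"

lemma val_measurable [measurable]: "n \<in> {1..m} \<Longrightarrow> val n b \<in> borel_measurable borel"
  unfolding val_def[abs_def]
  by (intro borel_measurable_max borel_measurable_sum borel_measurable_times borel_measurable_const
      payoff_measurable basis_measurable) auto

lemma val_S_measurable [measurable]:
  "n \<in> {1..m} \<Longrightarrow> (\<lambda>\<omega>. val n b (S (t n) \<omega>)) \<in> borel_measurable M"
  by (rule measurable_compose[OF S_measurable val_measurable])

text \<open>The square of a maximum is at most the sum of the squares, and Cauchy-Schwarz splits the
  continuation value into the squared length of \<open>b\<close> and squares of basis functions.
  What remains are products of two squares, controlled by fourth moments. The coefficients are
  deterministic here; random ones are inserted later by freezing them.\<close>

lemma val_psi_sq: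
  assumes n: "n \<in> {1..m - 1}" and k: "k \<le> K"
  shows "integrable M (\<lambda>\<omega>. (val (n + 1) b (S (t (n + 1)) \<omega>) * \<psi> n k (S (t n) \<omega>))\<^sup>2)"
    and "(LINT \<omega>|M. (val (n + 1) b (S (t (n + 1)) \<omega>) * \<psi> n k (S (t n) \<omega>))\<^sup>2)
      \<le> c ^ K * q + (real K + 1) * q * (\<Sum>l\<le>K. (b l)\<^sup>2)"
proof -
  have n1: "n \<in> {1..m}" "n + 1 \<in> {1..m}" "n + 1 \<in> {2..m}" using n by auto
  let ?h = "\<lambda>\<omega>. h (n + 1) (S (t (n + 1)) \<omega>)"
  let ?\<phi> = "\<lambda>l \<omega>. \<psi> (n + 1) l (S (t (n + 1)) \<omega>)"
  let ?\<psi> = "\<lambda>\<omega>. \<psi> n k (S (t n) \<omega>)"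
  let ?b = "\<Sum>l\<le>K. (b l)\<^sup>2"
  let ?bd = "\<lambda>\<omega>. (?h \<omega>)\<^sup>2 * (?\<psi> \<omega>)\<^sup>2 + ?b * (\<Sum>l\<le>K. (?\<phi> l \<omega>)\<^sup>2 * (?\<psi> \<omega>)\<^sup>2)"
  note meas[measurable] = psi_S_measurable[OF n1(1)] psi_S_measurable[OF n1(2)]
    payoff_S_measurable[OF n1(2)] val_S_measurable[OF n1(2)]
  have "expectation (\<lambda>\<omega>. (?h \<omega>) ^ 4) \<le> (c ^ K)\<^sup>2 * q"
  proof -
    have "expectation (\<lambda>\<omega>. (?h \<omega>) ^ 4)
        \<le> (t (n + 1) / t n) ^ (2 * K) * (LINT \<omega>|M. (\<psi> (n + 1) K (S (t (n + 1)) \<omega>)) ^ 4)"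
      using B3[OF n1(3)] by simp
    also have "\<dots> \<le> c ^ (2 * K) * q"
      using c_ge[OF n] c_nonneg psi_4_le_q[OF n1(2)]
      by (intro mult_mono power_mono) auto
    also have "c ^ (2 * K) = (c ^ K)\<^sup>2"
      by (simp add: power_mult[symmetric] mult.commute)
    finally show ?thesis .
  qed
  then have hq: "integrable M (\<lambda>\<omega>. (?h \<omega>)\<^sup>2 * (?\<psi> \<omega>)\<^sup>2)"
    "expectation (\<lambda>\<omega>. (?h \<omega>)\<^sup>2 * (?\<psi> \<omega>)\<^sup>2) \<le> c ^ K * q"
    using sq_mult_sq_le[OF meas(3) meas(1) finite_payoff[OF n1(3)] _ finite_basis[OF n1(1)]
        psi_4_le_q[OF n1(1) k], of "c ^ K"] c_nonneg
    by simp_all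
  have \<phi>q: "integrable M (\<lambda>\<omega>. (?\<phi> l \<omega>)\<^sup>2 * (?\<psi> \<omega>)\<^sup>2)"
    "expectation (\<lambda>\<omega>. (?\<phi> l \<omega>)\<^sup>2 * (?\<psi> \<omega>)\<^sup>2) \<le> 1 * q" if "l \<le> K" for l
    using sq_mult_sq_le[OF meas(2) meas(1) finite_basis[OF n1(2)] _ finite_basis[OF n1(1)]
        psi_4_le_q[OF n1(1) k], of l 1] psi_4_le_q[OF n1(2) that]
    by simp_all
  have sum_int: "integrable M (\<lambda>\<omega>. \<Sum>l\<le>K. (?\<phi> l \<omega>)\<^sup>2 * (?\<psi> \<omega>)\<^sup>2)"
    using \<phi>q(1) by (intro Bochner_Integration.integrable_sum) auto
  have bd_int: "integrable M ?bd"
    by (intro Bochner_Integration.integrable_add integrable_mult_right hq(1) sum_int)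
  have bd: "(val (n + 1) b (S (t (n + 1)) \<omega>) * ?\<psi> \<omega>)\<^sup>2 \<le> ?bd \<omega>" for \<omega>
  proof -
    have "(val (n + 1) b (S (t (n + 1)) \<omega>))\<^sup>2 \<le> (?h \<omega>)\<^sup>2 + (\<Sum>l\<le>K. b l * ?\<phi> l \<omega>)\<^sup>2"
      by (simp add: val_def max_def)
    also have "\<dots> \<le> (?h \<omega>)\<^sup>2 + ?b * (\<Sum>l\<le>K. (?\<phi> l \<omega>)\<^sup>2)"
      by (intro add_left_mono Cauchy_Schwarz_ineq_sum)
    finally have "(val (n + 1) b (S (t (n + 1)) \<omega>))\<^sup>2 * (?\<psi> \<omega>)\<^sup>2
        \<le> ((?h \<omega>)\<^sup>2 + ?b * (\<Sum>l\<le>K. (?\<phi> l \<omega>)\<^sup>2)) * (?\<psi> \<omega>)\<^sup>2"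
      by (rule mult_right_mono) simp
    then show ?thesis
      by (simp only: power_mult_distrib distrib_right sum_distrib_right mult.assoc)
  qed
  show int: "integrable M (\<lambda>\<omega>. (val (n + 1) b (S (t (n + 1)) \<omega>) * ?\<psi> \<omega>)\<^sup>2)"
  proof (rule Bochner_Integration.integrable_bound[OF bd_int])
    show "AE \<omega> in M. norm ((val (n + 1) b (S (t (n + 1)) \<omega>) * ?\<psi> \<omega>)\<^sup>2) \<le> norm (?bd \<omega>)"
    proof (rule AE_I2)
      fix \<omega> show "norm ((val (n + 1) b (S (t (n + 1)) \<omega>) * ?\<psi> \<omega>)\<^sup>2) \<le> norm (?bd \<omega>)"
        using order_trans[OF bd[of \<omega>] abs_ge_self] by (simp only: real_norm_def abs_power2)
    qed
  qed measurable
  have "(LINT \<omega>|M. (val (n + 1) b (S (t (n + 1)) \<omega>) * ?\<psi> \<omega>)\<^sup>2) \<le> expectation ?bd"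
    by (rule integral_mono[OF int bd_int bd])
  also have "\<dots> = expectation (\<lambda>\<omega>. (?h \<omega>)\<^sup>2 * (?\<psi> \<omega>)\<^sup>2)
      + ?b * (\<Sum>l\<le>K. expectation (\<lambda>\<omega>. (?\<phi> l \<omega>)\<^sup>2 * (?\<psi> \<omega>)\<^sup>2))"
  proof -
    have "expectation (\<lambda>\<omega>. \<Sum>l\<le>K. (?\<phi> l \<omega>)\<^sup>2 * (?\<psi> \<omega>)\<^sup>2)
        = (\<Sum>l\<le>K. expectation (\<lambda>\<omega>. (?\<phi> l \<omega>)\<^sup>2 * (?\<psi> \<omega>)\<^sup>2))"
      using \<phi>q(1) by (intro Bochner_Integration.integral_sum) auto
    moreover have "expectation ?bd = expectation (\<lambda>\<omega>. (?h \<omega>)\<^sup>2 * (?\<psi> \<omega>)\<^sup>2)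
        + expectation (\<lambda>\<omega>. ?b * (\<Sum>l\<le>K. (?\<phi> l \<omega>)\<^sup>2 * (?\<psi> \<omega>)\<^sup>2))"
      by (intro Bochner_Integration.integral_add integrable_mult_right hq(1) sum_int)
    ultimately show ?thesis by simp
  qed
  also have "\<dots> \<le> c ^ K * q + ?b * (\<Sum>l\<le>K. 1 * q)"
    using hq(2) \<phi>q(2) by (intro add_mono mult_left_mono sum_mono sum_nonneg) auto
  also have "\<dots> = c ^ K * q + (real K + 1) * q * ?b"
    by (simp add: algebra_simps)
  finally show "(LINT \<omega>|M. (val (n + 1) b (S (t (n + 1)) \<omega>) * ?\<psi> \<omega>)\<^sup>2)
      \<le> c ^ K * q + (real K + 1) * q * ?b" .
qed

text \<open>Taking the maximum with a fixed payoff is 1-Lipschitz, so the values differ by no more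
  than the continuation values; Cauchy-Schwarz then splits off the factor \<open>p\<close> of the
  basis function.\<close>

lemma val_psi_diff_sq_le:
  assumes n: "n \<in> {1..m - 1}" and k: "k \<le> K"
  shows "((LINT \<omega>|M. val (n + 1) b (S (t (n + 1)) \<omega>) * \<psi> n k (S (t n) \<omega>))
      - (LINT \<omega>|M. val (n + 1) b' (S (t (n + 1)) \<omega>) * \<psi> n k (S (t n) \<omega>)))\<^sup>2
    \<le> p * (LINT \<omega>|M. (\<Sum>l\<le>K. (b l - b' l) * \<psi> (n + 1) l (S (t (n + 1)) \<omega>))\<^sup>2)"
proof -
  have n1: "n \<in> {1..m}" "n + 1 \<in> {1..m}" using n by auto
  let ?v = "\<lambda>b \<omega>. val (n + 1) b (S (t (n + 1)) \<omega>)"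
  let ?\<psi> = "\<lambda>\<omega>. \<psi> n k (S (t n) \<omega>)"
  let ?d = "\<lambda>\<omega>. \<Sum>l\<le>K. (b l - b' l) * \<psi> (n + 1) l (S (t (n + 1)) \<omega>)"
  note [measurable] = psi_S_measurable[OF n1(1)] psi_S_measurable[OF n1(2)] val_S_measurable[OF n1(2)]
  have int: "integrable M (\<lambda>\<omega>. ?v b \<omega> * ?\<psi> \<omega>)" for b
    by (rule square_integrable_imp_integrable[OF _ val_psi_sq(1)[OF n k]]) measurable
  have d_int: "integrable M (\<lambda>\<omega>. (?d \<omega>)\<^sup>2)"
    by (rule combination_sq(1)[OF n1(2)])
  have le: "(?v b \<omega> - ?v b' \<omega>)\<^sup>2 \<le> (?d \<omega>)\<^sup>2" for \<omega>
  proof -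
    have "\<bar>max u x - max u y\<bar> \<le> \<bar>x - y\<bar>" for u x y :: real by (auto simp: max_def)
    then have "\<bar>?v b \<omega> - ?v b' \<omega>\<bar> \<le> \<bar>?d \<omega>\<bar>"
      unfolding val_def left_diff_distrib sum_subtractf .
    then show ?thesis by (simp only: abs_le_square_iff)
  qed
  have v_int: "integrable M (\<lambda>\<omega>. (?v b \<omega> - ?v b' \<omega>)\<^sup>2)"
    by (rule Bochner_Integration.integrable_bound[OF d_int]) (measurable, simp only: le AE_I2 real_norm_def abs_power2)
  have "((LINT \<omega>|M. ?v b \<omega> * ?\<psi> \<omega>) - (LINT \<omega>|M. ?v b' \<omega> * ?\<psi> \<omega>))\<^sup>2
      = (LINT \<omega>|M. (?v b \<omega> - ?v b' \<omega>) * ?\<psi> \<omega>)\<^sup>2"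
    using int by (simp add: left_diff_distrib)
  also have "\<dots> \<le> (LINT \<omega>|M. (?v b \<omega> - ?v b' \<omega>)\<^sup>2) * (LINT \<omega>|M. (?\<psi> \<omega>)\<^sup>2)"
    by (rule integral_Cauchy_Schwarz[OF _ psi_S_measurable[OF n1(1)] v_int
          psi_S_sq_integrable[OF n1(1)]]) measurable
  also have "\<dots> \<le> (LINT \<omega>|M. (?d \<omega>)\<^sup>2) * p"
    using integral_mono[OF v_int d_int le] psi_sq_le_p[OF n1(1) k]
    by (intro mult_mono) auto
  finally show ?thesis by (simp add: mult.commute)
qed

section \<open>Backward recursion of the estimation error\<close>

text \<open>The value 0 at date \<open>m\<close>, here and for the moment vectors below, makes date \<open>m\<close> a trivial base
  case of the backward inductions.\<close>

definition coef :: "(nat \<Rightarrow> ('a \<Rightarrow> real) \<Rightarrow> real Matrix.vec) \<Rightarrow> nat \<Rightarrow> nat \<Rightarrow> real" where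
  "coef b n k =
    (if n < m then vec_index (b n (\<lambda>x. max (h (n + 1) x) (cont_value m h \<psi> K b (n + 1) x))) k else 0)"

lemma cont_value_eq: "cont_value m h \<psi> K b n x = (\<Sum>k\<le>K. coef b n k * \<psi> n k x)"
  by (subst cont_value.simps)
    (simp add: coef_def Let_def scalar_prod_def basis_vec_def atLeast0LessThan
      lessThan_Suc_atMost del: sum.lessThan_Suc)

lemma max_cont_value_eq: "(\<lambda>x. max (h n x) (cont_value m h \<psi> K b n x)) = val n (coef b n)"
  by (simp add: val_def cont_value_eq fun_eq_iff)

lemma val_cong: "(\<And>l. l \<le> K \<Longrightarrow> b l = b' l) \<Longrightarrow> val n b = val n b'"
  by (simp add: val_def fun_eq_iff)

lemma P_mult_vec:
  assumes "n \<in> {1..m}" "i \<le> K"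
  shows "vec_index (P n *\<^sub>v vec (K + 1) f) i = (\<Sum>j\<le>K. P n $$ (i, j) * f j)"
proof -
  have "dim_row (P n) = K + 1" "dim_col (P n) = K + 1"
    using P_carrier[OF assms(1)] by auto
  then show ?thesis
    using assms(2) by (simp add: scalar_prod_def atLeast0LessThan lessThan_Suc_atMost
        del: sum.lessThan_Suc)
qed

abbreviation "\<beta> \<equiv> coef (exact_coef M S t \<psi> K)"
abbreviation "\<beta>_est N y \<equiv> coef (est_coef M S t \<psi> K N y)"

definition \<gamma> :: "nat \<Rightarrow> nat \<Rightarrow> real" where
  "\<gamma> n k =
    (if n < m then LINT \<omega>|M. val (n + 1) (\<beta> (n + 1)) (S (t (n + 1)) \<omega>) * \<psi> n k (S (t n) \<omega>) else 0)"

definition \<gamma>_est :: "nat \<Rightarrow> (nat \<Rightarrow> nat \<Rightarrow> nat \<Rightarrow> 'a) \<Rightarrow> nat \<Rightarrow> nat \<Rightarrow> real" where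
  "\<gamma>_est N y n k =
    (if n < m then (\<Sum>i=1..N. val (n + 1) (\<beta>_est N y (n + 1)) (y n i (n + 1)) * \<psi> n k (y n i n)) / real N
     else 0)"

text \<open>This includes date \<open>m\<close>, where the default values make both sides 0.\<close>

lemma \<beta>_eq: "n \<in> {1..m} \<Longrightarrow> i \<le> K \<Longrightarrow> \<beta> n i = (\<Sum>j\<le>K. P n $$ (i, j) * \<gamma> n j)"
  by (auto simp: coef_def[of _ n] \<gamma>_def exact_coef_def P_mult_vec max_cont_value_eq
      simp del: One_nat_def)

lemma \<beta>_est_eq:
  "n \<in> {1..m} \<Longrightarrow> i \<le> K \<Longrightarrow> \<beta>_est N y n i = (\<Sum>j\<le>K. P n $$ (i, j) * \<gamma>_est N y n j)"
  by (auto simp: coef_def[of _ n] \<gamma>_est_def est_coef_def P_mult_vec max_cont_value_eq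
      simp del: One_nat_def)

lemma \<beta>_est_sq_le:
  assumes "n \<in> {1..m}"
  shows "(\<Sum>l\<le>K. (\<beta>_est N y n l)\<^sup>2) \<le> B\<^sup>2 * (\<Sum>l\<le>K. (\<gamma>_est N y n l)\<^sup>2)"
proof (cases "n < m")
  case True
  then show ?thesis
    using P_coef_sq_le[of n "\<gamma>_est N y n"] assms by (simp add: \<beta>_est_eq)
qed (simp add: coef_def \<gamma>_est_def)

lemma \<beta>_diff_eq:
  assumes "n \<in> {1..m}" "i \<le> K"
  shows "\<beta>_est N y n i - \<beta> n i = (\<Sum>j\<le>K. P n $$ (i, j) * (\<gamma>_est N y n j - \<gamma> n j))"
  using assms by (simp add: \<beta>_est_eq \<beta>_eq sum_subtractf right_diff_distrib)

text \<open>This closed form serves twice: for the bound below and, being a polynomial in the moment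
  errors, for the measurability of the error in the simulated paths.\<close>

lemma cont_diff_sq:
  assumes n: "n \<in> {1..m - 1}"
  shows "(LINT \<omega>|M. (\<Sum>l\<le>K. (\<beta>_est N y n l - \<beta> n l) * \<psi> n l (S (t n) \<omega>))\<^sup>2)
    = (\<Sum>i\<le>K. (\<Sum>j\<le>K. P n $$ (i, j) * (\<gamma>_est N y n j - \<gamma> n j)) * (\<gamma>_est N y n i - \<gamma> n i))"
proof -
  have "n \<in> {1..m}" using n by auto
  then show ?thesis
    using combination_P_sq(1)[OF n, of "\<lambda>j. \<gamma>_est N y n j - \<gamma> n j"]
    by (simp add: \<beta>_diff_eq)
qed

lemma cont_diff_sq_le:
  assumes n: "n \<in> {1..m}"
  shows "(LINT \<omega>|M. (\<Sum>l\<le>K. (\<beta>_est N y n l - \<beta> n l) * \<psi> n l (S (t n) \<omega>))\<^sup>2)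
    \<le> B * (\<Sum>l\<le>K. (\<gamma>_est N y n l - \<gamma> n l)\<^sup>2)"
proof (cases "n < m")
  case True
  then have "n \<in> {1..m - 1}" using n by auto
  then show ?thesis unfolding cont_diff_sq[OF \<open>n \<in> {1..m - 1}\<close>] by (rule combination_P_sq(2))
qed (simp add: coef_def \<gamma>_est_def \<gamma>_def)

section \<open>Measurability of the estimators and the paths they depend on\<close>

abbreviation path_spaces :: "nat \<times> nat \<Rightarrow> (nat \<Rightarrow> 'a) measure" where
  "path_spaces \<equiv> \<lambda>(n, i). PiM {1..n + 1} (\<lambda>_. borel)"

text \<open>Product spaces are indexed by pairs of a date and a path number, whereas the estimators
  take these as two arguments.\<close>

abbreviation curried :: "(nat \<times> nat \<Rightarrow> nat \<Rightarrow> 'a) \<Rightarrow> nat \<Rightarrow> nat \<Rightarrow> nat \<Rightarrow> 'a" where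
  "curried z \<equiv> \<lambda>n i. z (n, i)"

lemma \<beta>_est_measurable:
  assumes "n \<in> {1..m}" "k \<le> K"
    and "\<And>j. j \<le> K \<Longrightarrow> (\<lambda>z. \<gamma>_est N (curried z) n j) \<in> borel_measurable MZ"
  shows "(\<lambda>z. \<beta>_est N (curried z) n k) \<in> borel_measurable MZ"
  unfolding \<beta>_est_eq[OF assms(1,2)]
  by (intro borel_measurable_sum borel_measurable_times borel_measurable_const assms(3)) auto

lemma val_\<beta>_est_measurable:
  assumes "n \<in> {1..m}"
    and "\<And>j. j \<le> K \<Longrightarrow> (\<lambda>y. \<beta>_est N (f y) n j) \<in> borel_measurable MZ"
    and g: "g \<in> borel_measurable MZ"
  shows "(\<lambda>y. val n (\<beta>_est N (f y) n) (g y)) \<in> borel_measurable MZ"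
  unfolding val_def using assms(1)
  by (intro borel_measurable_max borel_measurable_sum borel_measurable_times assms(2)
      measurable_compose[OF g payoff_measurable] measurable_compose[OF g basis_measurable]) auto

text \<open>The index set \<open>J\<close> is left free because two choices occur: the paths of the
  later dates only, when conditioning on them, and all paths, when the final error is shown to be
  measurable.\<close>

lemma \<gamma>_est_measurable:
  assumes "n \<in> {1..m}" "{n..m - 1} \<times> {1..N} \<subseteq> J"
  shows "(\<lambda>z. \<gamma>_est N (curried z) n k) \<in> borel_measurable (PiM J path_spaces)"
proof -
  have "n \<le> m" using assms by simp
  then show ?thesis
  proof (induction arbitrary: k rule: inc_induct)
    case base
    then show ?case by (simp add: \<gamma>_est_def)
  next
    case (step n')
    have comp: "(\<lambda>z. z (n', i) l) \<in> borel_measurable (PiM J path_spaces)"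
      if "i \<in> {1..N}" "l \<in> {1..n' + 1}" for i l
    proof -
      have "(n', i) \<in> J" using that step assms by auto
      from measurable_component_singleton[OF this, of path_spaces]
      have "(\<lambda>z. z (n', i)) \<in> PiM J path_spaces \<rightarrow>\<^sub>M PiM {1..n' + 1} (\<lambda>_. borel)" by simp
      from measurable_compose[OF this measurable_component_singleton[OF that(2)]]
      show ?thesis by simp
    qed
    have "Suc n' \<in> {1..m}" "n' \<in> {1..m}" using step assms by auto
    then have "(\<lambda>z. val (n' + 1) (\<beta>_est N (curried z) (n' + 1)) (z (n', i) (n' + 1)) * \<psi> n' k (z (n', i) n'))
        \<in> borel_measurable (PiM J path_spaces)" if "i \<in> {1..N}" for i
      using that step
      by (intro borel_measurable_times val_\<beta>_est_measurable \<beta>_est_measurable comp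
          measurable_compose[OF comp basis_measurable]) auto
    then show ?case
      using step unfolding \<gamma>_est_def
      by (auto intro!: borel_measurable_divide borel_measurable_sum borel_measurable_const
          simp del: One_nat_def)
  qed
qed

text \<open>The moment vector of a date reads only the paths simulated for that date and later ones.
  Hence the coefficients of date \<open>n + 1\<close> are independent of the paths of date
  \<open>n\<close>.\<close>

lemma \<gamma>_est_cong:
  assumes "n \<in> {1..m}" "\<And>j i. j \<in> {n..<m} \<Longrightarrow> i \<in> {1..N} \<Longrightarrow> y j i = y' j i"
  shows "\<gamma>_est N y n k = \<gamma>_est N y' n k"
proof -
  have "n \<le> m" using assms by simp
  then show ?thesis
  proof (induction arbitrary: k rule: inc_induct)
    case base
    then show ?case by (simp add: \<gamma>_est_def)
  next
    case (step n')
    have n': "n' + 1 \<in> {1..m}" using step by auto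
    have "val (n' + 1) (\<beta>_est N y (n' + 1)) = val (n' + 1) (\<beta>_est N y' (n' + 1))"
      using step.IH n' by (intro val_cong) (simp add: \<beta>_est_eq)
    moreover have "y n' i = y' n' i" if "i \<in> {1..N}" for i
      using assms(2)[of n' i] step that by simp
    ultimately show ?case
      by (simp add: \<gamma>_est_def)
  qed
qed

lemma \<beta>_est_cong:
  assumes "n \<in> {1..m}" "\<And>j i. j \<in> {n..<m} \<Longrightarrow> i \<in> {1..N} \<Longrightarrow> y j i = y' j i" "k \<le> K"
  shows "\<beta>_est N y n k = \<beta>_est N y' n k"
  using \<gamma>_est_cong[of n N y y'] assms by (simp add: \<beta>_est_eq)

text \<open>One step of the backward recursion, by \<open>monte_carlo_second_moments\<close>.
  Freezing the paths of the later dates makes the coefficients of date \<open>n + 1\<close>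
  deterministic, and a fresh path has the law of the process; so \<open>val_psi_sq\<close> bounds
  the conditional second moment and \<open>val_psi_diff_sq_le\<close> the conditional bias.\<close>

lemma estimator_step:
  assumes sim: "simulated_paths M S t m N Q Y" and N: "1 \<le> N" and n: "n \<in> {1..m - 1}" and k: "k \<le> K"
    and int_est: "\<And>l. l \<le> K \<Longrightarrow> integrable Q (\<lambda>\<omega>. (\<gamma>_est N (\<lambda>n i. Y n i \<omega>) (n + 1) l)\<^sup>2)"
    and int_err: "\<And>l. l \<le> K \<Longrightarrow>
      integrable Q (\<lambda>\<omega>. (\<gamma>_est N (\<lambda>n i. Y n i \<omega>) (n + 1) l - \<gamma> (n + 1) l)\<^sup>2)"
  defines "W \<equiv> c ^ K * q + (real K + 1) * q * (B\<^sup>2 *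
      (\<Sum>l\<le>K. LINT \<omega>|Q. (\<gamma>_est N (\<lambda>n i. Y n i \<omega>) (n + 1) l)\<^sup>2))"
    and "V \<equiv> p * (B *
      (\<Sum>l\<le>K. LINT \<omega>|Q. (\<gamma>_est N (\<lambda>n i. Y n i \<omega>) (n + 1) l - \<gamma> (n + 1) l)\<^sup>2))"
  shows "integrable Q (\<lambda>\<omega>. (\<gamma>_est N (\<lambda>n i. Y n i \<omega>) n k)\<^sup>2)"
    and "(LINT \<omega>|Q. (\<gamma>_est N (\<lambda>n i. Y n i \<omega>) n k)\<^sup>2) \<le> W"
    and "integrable Q (\<lambda>\<omega>. (\<gamma>_est N (\<lambda>n i. Y n i \<omega>) n k - \<gamma> n k)\<^sup>2)"
    and "(LINT \<omega>|Q. (\<gamma>_est N (\<lambda>n i. Y n i \<omega>) n k - \<gamma> n k)\<^sup>2) \<le> W / real N + V"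
proof -
  interpret Q: prob_space Q using sim by (simp add: simulated_paths_def)
  have n1: "n \<in> {1..m}" "n + 1 \<in> {1..m}" "n < m" using n by auto
  define I0 where "I0 = {1..m - 1} \<times> {1..N}"
  define J where "J = {n + 1..m - 1} \<times> {1..N}"
  define X where "X = (\<lambda>(n, i). Y n i)"
  define MZ where "MZ = PiM J path_spaces"
  define MX where "MX = PiM {1..n + 1} (\<lambda>_. borel :: 'a measure)"
  define Z where "Z \<omega> = (\<lambda>b\<in>J. X b \<omega>)" for \<omega>
  define path where "path \<omega> = (\<lambda>j\<in>{1..n + 1}. S (t j) \<omega>)" for \<omega>
  define \<mu> where "\<mu> = distr M MX path"
  \<comment> \<open>One summand of the estimator, as a function of the later paths (first component)
    and of one fresh path (second component).\<close>
  define F where "F y = val (n + 1) (\<beta>_est N (curried (fst y)) (n + 1)) (snd y (n + 1)) * \<psi> n k (snd y n)"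
    for y :: "(nat \<times> nat \<Rightarrow> nat \<Rightarrow> 'a) \<times> (nat \<Rightarrow> 'a)"
  have vars: "Q.indep_vars path_spaces X I0"
    using sim by (simp add: simulated_paths_def X_def I0_def)
  have J_sub: "J \<subseteq> I0" using n by (auto simp: J_def I0_def)
  have in_I0: "(n, i) \<in> I0" "(n, i) \<notin> J" if "i \<in> {1..N}" for i
    using that n by (auto simp: J_def I0_def)
  have ind: "Q.indep_pair MZ Z MX (Y n i)" if "i \<in> {1..N}" for i
    using Q.indep_vars_indep_pair[OF vars J_sub in_I0[OF that]]
    by (simp add: MZ_def MX_def X_def Z_def[abs_def])
  have ind2: "Q.indep_pair (MZ \<Otimes>\<^sub>M MX) (\<lambda>\<omega>. (Z \<omega>, Y n i \<omega>)) MX (Y n j)"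
    if ij: "i \<in> {1..N}" "j \<in> {1..N}" "i \<noteq> j" for i j
  proof -
    \<comment> \<open>Joint independence comes from enlarging the block by the path
      \<open>(n, i)\<close>, and is then read through the map that separates this path from the
      block.\<close>
    let ?J = "insert (n, i) J"
    have *: "Q.indep_pair (PiM ?J path_spaces) (\<lambda>\<omega>. \<lambda>b\<in>?J. X b \<omega>) MX (Y n j)"
      using Q.indep_vars_indep_pair[OF vars, of ?J "(n, j)"] J_sub in_I0 ij
      by (simp add: MX_def X_def)
    have "(\<lambda>z. (restrict z J, z (n, i))) \<in> PiM ?J path_spaces \<rightarrow>\<^sub>M MZ \<Otimes>\<^sub>M MX"
    proof (rule measurable_Pair)
      show "(\<lambda>z. restrict z J) \<in> PiM ?J path_spaces \<rightarrow>\<^sub>M MZ"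
        unfolding MZ_def by (rule measurable_restrict_subset) auto
      show "(\<lambda>z. z (n, i)) \<in> PiM ?J path_spaces \<rightarrow>\<^sub>M MX"
        using measurable_component_singleton[of "(n, i)" ?J path_spaces] by (simp add: MX_def)
    qed
    from Q.indep_pair_compose[OF * this measurable_ident]
    have "Q.indep_pair (MZ \<Otimes>\<^sub>M MX) (\<lambda>\<omega>. (restrict (\<lambda>b\<in>?J. X b \<omega>) J, (\<lambda>b\<in>?J. X b \<omega>) (n, i)))
        MX (Y n j)" by simp
    moreover have "restrict (\<lambda>b\<in>?J. X b \<omega>) J = Z \<omega>" for \<omega>
      by (auto simp: Z_def)
    ultimately show ?thesis by (simp add: X_def)
  qed
  have path_meas: "path \<in> M \<rightarrow>\<^sub>M MX"
    unfolding path_def[abs_def] MX_def using S_measurable n by (intro measurable_restrict) auto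
  have law: "distr Q MX (Y n i) = \<mu>" if "i \<in> {1..N}" for i
    using sim n that by (simp add: simulated_paths_def \<mu>_def MX_def path_def[abs_def])
  have \<gamma>_meas: "(\<lambda>z. \<gamma>_est N (curried z) (n + 1) l) \<in> borel_measurable MZ" for l
    unfolding MZ_def J_def by (rule \<gamma>_est_measurable[OF n1(2) subset_refl])
  have Z_eq: "curried (Z \<omega>) j i = Y j i \<omega>" if "j \<in> {n + 1..<m}" "i \<in> {1..N}" for j i \<omega>
    using that by (auto simp: Z_def X_def J_def)
  have \<gamma>_Z: "\<gamma>_est N (curried (Z \<omega>)) (n + 1) l = \<gamma>_est N (\<lambda>n i. Y n i \<omega>) (n + 1) l" for \<omega> l
    \<comment> \<open>\<open>Z\<close> is undefined outside \<open>J\<close>, which is harmless: the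
      estimator of date \<open>n + 1\<close> looks only at indices in \<open>J\<close>.\<close>
    by (rule \<gamma>_est_cong[OF n1(2) Z_eq])
  have val_Z: "val (n + 1) (\<beta>_est N (curried (Z \<omega>)) (n + 1))
      = val (n + 1) (\<beta>_est N (\<lambda>n i. Y n i \<omega>) (n + 1))" for \<omega>
    by (rule val_cong) (rule \<beta>_est_cong[OF n1(2) Z_eq])
  have comp: "(\<lambda>x. x l) \<in> MX \<rightarrow>\<^sub>M borel" if "l \<in> {1..n + 1}" for l
    unfolding MX_def by (rule measurable_component_singleton[OF that])
  have F_meas: "F \<in> borel_measurable (MZ \<Otimes>\<^sub>M MX)"
    unfolding F_def[abs_def]
  proof (intro borel_measurable_times)
    show "(\<lambda>y. val (n + 1) (\<beta>_est N (curried (fst y)) (n + 1)) (snd y (n + 1)))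
        \<in> borel_measurable (MZ \<Otimes>\<^sub>M MX)"
    proof (rule val_\<beta>_est_measurable[OF n1(2)])
      show "(\<lambda>y. \<beta>_est N (curried (fst y)) (n + 1) j) \<in> borel_measurable (MZ \<Otimes>\<^sub>M MX)" if "j \<le> K" for j
        by (rule measurable_compose[OF measurable_fst \<beta>_est_measurable[OF n1(2) that \<gamma>_meas]])
      show "(\<lambda>y. snd y (n + 1)) \<in> borel_measurable (MZ \<Otimes>\<^sub>M MX)"
        by (rule measurable_compose[OF measurable_snd comp]) simp
    qed
    have "(\<lambda>y. snd y n) \<in> borel_measurable (MZ \<Otimes>\<^sub>M MX)"
      by (rule measurable_compose[OF measurable_snd comp]) (use n in simp)
    from measurable_compose[OF this basis_measurable[OF n1(1)]]
    show "(\<lambda>y. \<psi> n k (snd y n)) \<in> borel_measurable (MZ \<Otimes>\<^sub>M MX)" .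
  qed
  have F_path: "F (z, path \<omega>)
      = val (n + 1) (\<beta>_est N (curried z) (n + 1)) (S (t (n + 1)) \<omega>) * \<psi> n k (S (t n) \<omega>)" for z \<omega>
    using n by (simp add: F_def path_def)
  have Fz_meas: "(\<lambda>x. F (z, x)) \<in> borel_measurable MX" if "z \<in> space MZ" for z
    using measurable_compose[OF measurable_Pair1'[OF that] F_meas] by simp
  \<comment> \<open>\<open>w\<close> and \<open>v\<close> are the conditional bounds given the later
    paths; their expectations are \<open>W\<close> and \<open>V\<close>.\<close>
  define w where "w z = c ^ K * q + (real K + 1) * q *
      (B\<^sup>2 * (\<Sum>l\<le>K. (\<gamma>_est N (curried z) (n + 1) l)\<^sup>2))" for z
  define v where "v z = p * (B * (\<Sum>l\<le>K. (\<gamma>_est N (curried z) (n + 1) l - \<gamma> (n + 1) l)\<^sup>2))" for z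
  have w_meas: "w \<in> borel_measurable MZ" and v_meas: "v \<in> borel_measurable MZ"
    unfolding w_def[abs_def] v_def[abs_def] using \<gamma>_meas by measurable
  have sq: "integrable \<mu> (\<lambda>x. (F (z, x))\<^sup>2)" "(LINT x|\<mu>. (F (z, x))\<^sup>2) \<le> w z"
    and bias: "((LINT x|\<mu>. F (z, x)) - \<gamma> n k)\<^sup>2 \<le> v z" if z: "z \<in> space MZ" for z
  proof -
    have F2: "(\<lambda>x. (F (z, x))\<^sup>2) \<in> borel_measurable MX"
      using Fz_meas[OF z] by measurable
    show "integrable \<mu> (\<lambda>x. (F (z, x))\<^sup>2)"
      unfolding \<mu>_def integrable_distr_eq[OF path_meas F2] F_path
      by (rule val_psi_sq(1)[OF n k])
    have "(LINT x|\<mu>. (F (z, x))\<^sup>2)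
        \<le> c ^ K * q + (real K + 1) * q * (\<Sum>l\<le>K. (\<beta>_est N (curried z) (n + 1) l)\<^sup>2)"
      unfolding \<mu>_def integral_distr[OF path_meas F2] F_path
      by (rule val_psi_sq(2)[OF n k])
    also have "\<dots> \<le> w z"
      unfolding w_def using q_ge_1
      by (intro add_left_mono mult_left_mono \<beta>_est_sq_le n1(2)) auto
    finally show "(LINT x|\<mu>. (F (z, x))\<^sup>2) \<le> w z" .
    have "((LINT x|\<mu>. F (z, x)) - \<gamma> n k)\<^sup>2 \<le> p * (LINT \<omega>|M.
        (\<Sum>l\<le>K. (\<beta>_est N (curried z) (n + 1) l - \<beta> (n + 1) l) * \<psi> (n + 1) l (S (t (n + 1)) \<omega>))\<^sup>2)"
      unfolding \<mu>_def integral_distr[OF path_meas Fz_meas[OF z]] F_path \<gamma>_def if_P[OF n1(3)]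
      by (rule val_psi_diff_sq_le[OF n k])
    also have "\<dots> \<le> v z"
      unfolding v_def using p_ge_1 by (intro mult_left_mono cont_diff_sq_le n1(2)) auto
    finally show "((LINT x|\<mu>. F (z, x)) - \<gamma> n k)\<^sup>2 \<le> v z" .
  qed
  have w_int: "integrable Q (\<lambda>\<omega>. w (Z \<omega>))" and v_int: "integrable Q (\<lambda>\<omega>. v (Z \<omega>))"
    unfolding w_def v_def \<gamma>_Z
    by (intro Bochner_Integration.integrable_add Q.integrable_const integrable_mult_right
        Bochner_Integration.integrable_sum int_est int_err, simp)+
  have w_E: "(LINT \<omega>|Q. w (Z \<omega>)) = W"
  proof -
    have int: "integrable Q (\<lambda>\<omega>. \<Sum>l\<le>K. (\<gamma>_est N (\<lambda>n i. Y n i \<omega>) (n + 1) l)\<^sup>2)"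
      by (intro Bochner_Integration.integrable_sum int_est) simp
    have "(LINT \<omega>|Q. w (Z \<omega>)) = c ^ K * q + (real K + 1) * q * (B\<^sup>2 *
        (LINT \<omega>|Q. (\<Sum>l\<le>K. (\<gamma>_est N (\<lambda>n i. Y n i \<omega>) (n + 1) l)\<^sup>2)))"
      unfolding w_def \<gamma>_Z using int
      by (subst Bochner_Integration.integral_add) (simp_all add: Q.prob_space)
    also have "\<dots> = W"
      unfolding W_def by (subst Bochner_Integration.integral_sum) (simp_all add: int_est[simplified])
    finally show ?thesis .
  qed
  have v_E: "(LINT \<omega>|Q. v (Z \<omega>)) = V"
    unfolding v_def \<gamma>_Z V_def
    by (simp add: Bochner_Integration.integral_sum int_err[simplified])
  have est: "\<gamma>_est N (\<lambda>n i. Y n i \<omega>) n k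
      = (\<Sum>i\<in>{1..N}. F (Z \<omega>, Y n i \<omega>)) / real (card {1..N})" for \<omega>
    by (simp only: \<gamma>_est_def F_def val_Z if_P[OF n1(3)] fst_conv snd_conv card_atLeastAtMost
        diff_Suc_1 add_diff_cancel_right')
  have "finite {1..N}" "{1..N} \<noteq> {}" using N by auto
  note mc = Q.monte_carlo_second_moments[where I = "{1..N}" and X = "Y n" and F = F and a = "\<gamma> n k",
      OF this ind ind2 law F_meas w_meas v_meas sq bias w_int v_int,
      folded est, unfolded w_E v_E card_atLeastAtMost diff_Suc_1]
  show "integrable Q (\<lambda>\<omega>. (\<gamma>_est N (\<lambda>n i. Y n i \<omega>) n k)\<^sup>2)"
    and "(LINT \<omega>|Q. (\<gamma>_est N (\<lambda>n i. Y n i \<omega>) n k)\<^sup>2) \<le> W"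
    and "integrable Q (\<lambda>\<omega>. (\<gamma>_est N (\<lambda>n i. Y n i \<omega>) n k - \<gamma> n k)\<^sup>2)"
    and "(LINT \<omega>|Q. (\<gamma>_est N (\<lambda>n i. Y n i \<omega>) n k - \<gamma> n k)\<^sup>2) \<le> W / real N + V"
    by (rule mc, assumption+)+
qed

text \<open>Downward induction from date \<open>m\<close>, where everything is 0. Integrability is
  part of the induction because each step needs it at the next date.\<close>

lemma estimator_bounds:
  assumes sim: "simulated_paths M S t m N Q Y" and N: "1 \<le> N" and n: "n \<in> {1..m}"
  shows "(\<forall>k\<le>K. integrable Q (\<lambda>\<omega>. (\<gamma>_est N (\<lambda>n i. Y n i \<omega>) n k)\<^sup>2) \<and>
      integrable Q (\<lambda>\<omega>. (\<gamma>_est N (\<lambda>n i. Y n i \<omega>) n k - \<gamma> n k)\<^sup>2)) \<and>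
    (\<Sum>k\<le>K. LINT \<omega>|Q. (\<gamma>_est N (\<lambda>n i. Y n i \<omega>) n k)\<^sup>2) \<le> real (m - n) * A ^ (m - n) \<and>
    (\<Sum>k\<le>K. LINT \<omega>|Q. (\<gamma>_est N (\<lambda>n i. Y n i \<omega>) n k - \<gamma> n k)\<^sup>2)
      \<le> (2 ^ (m - n) - 1) * ((real K + 1)\<^sup>2 * p\<^sup>2) * A ^ (m - n) / real N"
proof -
  have "n \<le> m" using n by simp
  then show ?thesis
  proof (induction rule: inc_induct)
    case base
    then show ?case by (simp add: \<gamma>_est_def \<gamma>_def)
  next
    case (step n')
    let ?w = "\<lambda>n. \<Sum>k\<le>K. LINT \<omega>|Q. (\<gamma>_est N (\<lambda>n i. Y n i \<omega>) n k)\<^sup>2"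
    let ?e = "\<lambda>n. \<Sum>k\<le>K. LINT \<omega>|Q. (\<gamma>_est N (\<lambda>n i. Y n i \<omega>) n k - \<gamma> n k)\<^sup>2"
    let ?W = "c ^ K * q + (real K + 1) * q * (B\<^sup>2 * ?w (n' + 1))" and ?V = "p * (B * ?e (n' + 1))"
    have n': "n' \<in> {1..m - 1}" using step n by auto
    have IH: "\<And>k. k \<le> K \<Longrightarrow> integrable Q (\<lambda>\<omega>. (\<gamma>_est N (\<lambda>n i. Y n i \<omega>) (n' + 1) k)\<^sup>2)"
      "\<And>k. k \<le> K \<Longrightarrow> integrable Q (\<lambda>\<omega>. (\<gamma>_est N (\<lambda>n i. Y n i \<omega>) (n' + 1) k - \<gamma> (n' + 1) k)\<^sup>2)"
      "?w (n' + 1) \<le> real (m - (n' + 1)) * A ^ (m - (n' + 1))"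
      "?e (n' + 1) \<le> (2 ^ (m - (n' + 1)) - 1) * ((real K + 1)\<^sup>2 * p\<^sup>2) * A ^ (m - (n' + 1)) / real N"
      using step.IH by simp_all
    note st = estimator_step[OF sim N n' _ IH(1,2)]
    have mn: "m - n' = Suc (m - (n' + 1))" using step by simp
    have w0: "0 \<le> ?w (n' + 1)" "0 \<le> ?e (n' + 1)" by (auto intro!: sum_nonneg)
    have W_le: "(real K + 1) * ?W \<le> A + A * ?w (n' + 1)"
    proof -
      have eq: "(real K + 1) * (c ^ K * q + (real K + 1) * q * (B\<^sup>2 * x))
          = (real K + 1) * (c ^ K * q) + (real K + 1)\<^sup>2 * (q * B\<^sup>2) * x" for x
        by (simp add: distrib_left power2_eq_square)
      show ?thesis
        unfolding eq by (intro add_mono A_bounds(1) mult_right_mono[OF A_bounds(2) w0(1)])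
    qed
    have W_le2: "(real K + 1) * ?W \<le> real (Suc (m - (n' + 1))) * A ^ Suc (m - (n' + 1))"
      by (rule second_moment_recursion[OF A_bounds(4) W_le IH(3)])
    have V_le: "(real K + 1) * ?V \<le> A * ?e (n' + 1)"
      using mult_right_mono[OF A_bounds(3) w0(2)] by (simp add: mult.assoc)
    \<comment> \<open>The bound of one component is the same for all \<open>k\<close>, so summation
      costs a factor \<open>K + 1\<close>.\<close>
    have "?w n' \<le> (\<Sum>k\<le>K. ?W)" using st(2) by (intro sum_mono) simp
    then have 1: "?w n' \<le> (real K + 1) * ?W" by (simp add: add.commute)
    have "?e n' \<le> (\<Sum>k\<le>K. ?W / real N + ?V)" using st(4) by (intro sum_mono) simp
    then have "?e n' \<le> (real K + 1) * ?W / real N + (real K + 1) * ?V"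
      by (simp add: add.commute distrib_left)
    with V_le have 2: "?e n' \<le> (real K + 1) * ?W / real N + A * ?e (n' + 1)" by linarith
    \<comment> \<open>This is the parameter \<open>s\<close> of
      \<open>error_recursion\<close>.\<close>
    have "1 * 1 \<le> (real K + 1)\<^sup>2 * p\<^sup>2" using p_ge_1 by (intro mult_mono one_le_power) auto
    then have s: "1 \<le> (real K + 1)\<^sup>2 * p\<^sup>2" by simp
    have "0 < real N" using N by simp
    from error_recursion[OF A_bounds(4) this s 2 W_le2 IH(4)] order_trans[OF 1 W_le2] st(1,3)
    show ?case unfolding mn by blast
  qed
qed

text \<open>For fixed simulated paths, the density turns the weighted norm into an expectation over
  the process itself. \<open>cont_diff_sq_le\<close> then reduces it to the moment errors, at the
  cost of the single factor \<open>B\<close> in the result.\<close>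

lemma approximation_error:
  assumes sim: "simulated_paths M S t m N Q Y" and N: "1 \<le> N" and n: "n \<in> {1..m - 1}"
    and g: "\<And>x. 0 \<le> g x" "distributed M lborel (S (t n)) (\<lambda>x. ennreal (g x))"
  defines "err \<equiv> \<lambda>\<omega>. (weighted_norm g (\<lambda>x. est_cont M S t m h \<psi> K N (\<lambda>n i. Y n i \<omega>) n x
      - exact_cont M S t m h \<psi> K n x))\<^sup>2"
  shows "integrable Q err"
    and "(LINT \<omega>|Q. err \<omega>)
      \<le> (2 ^ (m - n) - 1) * ((real K + 1)\<^sup>2 / real N) * B * A ^ (m - n) * p\<^sup>2"
proof -
  interpret Q: prob_space Q using sim by (simp add: simulated_paths_def)
  have n1: "n \<in> {1..m}" using n by auto
  let ?\<delta> = "\<lambda>\<omega> k. \<gamma>_est N (\<lambda>n i. Y n i \<omega>) n k - \<gamma> n k"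
  have diff: "est_cont M S t m h \<psi> K N (\<lambda>n i. Y n i \<omega>) n x - exact_cont M S t m h \<psi> K n x
      = (\<Sum>k\<le>K. (\<beta>_est N (\<lambda>n i. Y n i \<omega>) n k - \<beta> n k) * \<psi> n k x)" for \<omega> x
    by (simp add: est_cont_def exact_cont_def cont_value_eq left_diff_distrib sum_subtractf)
  have err_eq: "err \<omega> = (LINT \<omega>'|M.
      (\<Sum>k\<le>K. (\<beta>_est N (\<lambda>n i. Y n i \<omega>) n k - \<beta> n k) * \<psi> n k (S (t n) \<omega>'))\<^sup>2)" for \<omega>
  proof -
    let ?G = "\<lambda>x. (\<Sum>k\<le>K. (\<beta>_est N (\<lambda>n i. Y n i \<omega>) n k - \<beta> n k) * \<psi> n k x)\<^sup>2"
    have "?G \<in> borel_measurable lborel"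
      using basis_measurable[OF n1] by measurable
    from distributed_integral[OF g(2) this g(1)]
    have "(LINT x|lborel. ?G x * g x) = (LINT \<omega>'|M. ?G (S (t n) \<omega>'))"
      by (simp add: mult.commute)
    \<comment> \<open>Needed to cancel the square against the root in
      \<open>weighted_norm\<close>.\<close>
    moreover have "0 \<le> (LINT x|lborel. ?G x * g x)"
      using g(1) by (intro Bochner_Integration.integral_nonneg) simp
    ultimately show ?thesis
      unfolding err_def weighted_norm_def diff by simp
  qed
  have bounds: "\<And>k. k \<le> K \<Longrightarrow> integrable Q (\<lambda>\<omega>. (?\<delta> \<omega> k)\<^sup>2)"
    "(\<Sum>k\<le>K. LINT \<omega>|Q. (?\<delta> \<omega> k)\<^sup>2)
      \<le> (2 ^ (m - n) - 1) * ((real K + 1)\<^sup>2 * p\<^sup>2) * A ^ (m - n) / real N"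
    using estimator_bounds[OF sim N n1] by auto
  have sum_int: "integrable Q (\<lambda>\<omega>. B * (\<Sum>k\<le>K. (?\<delta> \<omega> k)\<^sup>2))"
    using bounds(1) by (intro integrable_mult_right Bochner_Integration.integrable_sum) simp
  have err_le: "err \<omega> \<le> B * (\<Sum>k\<le>K. (?\<delta> \<omega> k)\<^sup>2)" for \<omega>
    unfolding err_eq by (rule cont_diff_sq_le[OF n1])
  have \<delta>_meas: "(\<lambda>\<omega>. ?\<delta> \<omega> k) \<in> borel_measurable Q" for k
  proof -
    let ?I = "{1..m - 1} \<times> {1..N}"
    have "Q.indep_vars path_spaces (\<lambda>(n, i). Y n i) ?I"
      using sim by (simp add: simulated_paths_def)
    then have Y: "(\<lambda>\<omega>. \<lambda>b\<in>?I. (\<lambda>(n, i). Y n i) b \<omega>) \<in> Q \<rightarrow>\<^sub>M PiM ?I path_spaces"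
      unfolding Q.indep_vars_def by (intro measurable_restrict) blast
    have "(\<lambda>\<omega>. \<gamma>_est N (curried (\<lambda>b\<in>?I. (\<lambda>(n, i). Y n i) b \<omega>)) n k) \<in> borel_measurable Q"
      using n by (intro measurable_compose[OF Y \<gamma>_est_measurable]) auto
    \<comment> \<open>Restricting the family to the simulated index set leaves the estimator
      unchanged.\<close>
    moreover have "\<gamma>_est N (curried (\<lambda>b\<in>?I. (\<lambda>(n, i). Y n i) b \<omega>)) n k
        = \<gamma>_est N (\<lambda>n i. Y n i \<omega>) n k" for \<omega>
      using n by (intro \<gamma>_est_cong) auto
    ultimately show ?thesis by simp
  qed
  have err_meas: "err \<in> borel_measurable Q"
    unfolding err_eq[abs_def] cont_diff_sq[OF n]
    by (intro borel_measurable_sum borel_measurable_times borel_measurable_const \<delta>_meas)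
  have err_nonneg: "0 \<le> err \<omega>" for \<omega> by (simp add: err_def)
  show err_int: "integrable Q err"
    by (rule Bochner_Integration.integrable_bound[OF sum_int err_meas])
      (simp add: err_nonneg order_trans[OF err_le abs_ge_self] del: abs_mult)
  have "(LINT \<omega>|Q. err \<omega>) \<le> (LINT \<omega>|Q. B * (\<Sum>k\<le>K. (?\<delta> \<omega> k)\<^sup>2))"
    by (rule integral_mono[OF err_int sum_int err_le])
  also have "\<dots> = B * (\<Sum>k\<le>K. LINT \<omega>|Q. (?\<delta> \<omega> k)\<^sup>2)"
    by (simp add: Bochner_Integration.integral_sum bounds(1))
  also have "\<dots> \<le> B * ((2 ^ (m - n) - 1) * ((real K + 1)\<^sup>2 * p\<^sup>2) * A ^ (m - n) / real N)"
    using B_ge_1 by (intro mult_left_mono bounds(2)) simp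
  finally show "(LINT \<omega>|Q. err \<omega>)
      \<le> (2 ^ (m - n) - 1) * ((real K + 1)\<^sup>2 / real N) * B * A ^ (m - n) * p\<^sup>2"
    by (simp add: mult_ac)
qed

end

section \<open>The error bound for every number of basis functions\<close>

theorem theorem3:
  fixes M :: "'w measure"
    and S :: "real \<Rightarrow> 'w \<Rightarrow> real ^ 'd"
    and s0 :: "real ^ 'd"
    and g :: "nat \<Rightarrow> real ^ 'd \<Rightarrow> real"
    and t :: "nat \<Rightarrow> real"
    and m :: nat
    and h :: "nat \<Rightarrow> nat \<Rightarrow> real ^ 'd \<Rightarrow> real"
    and \<psi> :: "nat \<Rightarrow> nat \<Rightarrow> real ^ 'd \<Rightarrow> real"
  assumes "m \<ge> 2"
    and "t 0 = 0" and "strict_mono_on {..m} t"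
    and "prob_space M" and "markov_process M S"
    and "AE \<omega> in M. S 0 \<omega> = s0"
    and density: "\<And>n. n \<in> {1..m} \<Longrightarrow>
           (\<forall>x. 0 \<le> g n x) \<and> distributed M lborel (S (t n)) (\<lambda>x. ennreal (g n x))"
    and payoff: "\<And>K n. n \<le> m \<Longrightarrow> h K n \<in> borel_measurable borel \<and> (\<forall>x. 0 \<le> h K n x)"
    and basis: "\<And>n k. n \<in> {1..m} \<Longrightarrow> \<psi> n k \<in> borel_measurable borel"
    and finite_basis: "\<And>n k. n \<in> {1..m} \<Longrightarrow> integrable M (\<lambda>\<omega>. (\<psi> n k (S (t n) \<omega>)) ^ 4)"
    and finite_payoff: "\<And>K n. n \<in> {2..m} \<Longrightarrow> integrable M (\<lambda>\<omega>. (h K n (S (t n) \<omega>)) ^ 4)"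
    and A0_const: "\<And>n x. n \<in> {1..m} \<Longrightarrow> \<psi> n 0 x = 1"
    and A0_mean: "\<And>n k. n \<in> {1..m} \<Longrightarrow> k \<ge> 1 \<Longrightarrow> (LINT \<omega>|M. \<psi> n k (S (t n) \<omega>)) = 0"
    and A0_finite: "\<And>n j k. n \<in> {1..m} \<Longrightarrow>
           integrable M (\<lambda>\<omega>. \<psi> n j (S (t n) \<omega>) * \<psi> n k (S (t n) \<omega>))"
    and A0_nonsingular: "\<And>K n. n \<in> {1..m} \<Longrightarrow> invertible_mat (gram M S t \<psi> K n)"
    and B1: "\<And>p n n' k k'. p \<in> {2, 4} \<Longrightarrow> 1 \<le> n \<Longrightarrow> n \<le> n' \<Longrightarrow> n' \<le> m \<Longrightarrow> k \<le> k' \<Longrightarrow>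
           (LINT \<omega>|M. (\<psi> n k (S (t n) \<omega>)) ^ p) \<le> (LINT \<omega>|M. (\<psi> n' k' (S (t n') \<omega>)) ^ p)"
    and B2: "\<And>K. euclid_norm (exact_beta M S t m (h K) \<psi> K (m - 1)) = 1"
    and B3: "\<And>K n. n \<in> {2..m} \<Longrightarrow>
           (LINT \<omega>|M. (h K n (S (t n) \<omega>)) ^ 4)
             \<le> (t n / t (n - 1)) ^ (2 * K) * (LINT \<omega>|M. (\<psi> n K (S (t n) \<omega>)) ^ 4)"
  shows "\<exists>\<epsilon> :: nat \<Rightarrow> real. \<epsilon> \<longlonglongrightarrow> 0 \<and>
    (\<forall>n\<in>{1..m - 1}. \<forall>K. \<forall>N\<ge>1.
       \<forall>(Q :: 'b measure) Y. simulated_paths M S t m N Q Y \<longrightarrow>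
         (let err = (\<lambda>\<omega>. (weighted_norm (g n)
                (\<lambda>x. est_cont M S t m (h K) \<psi> K N (\<lambda>n i. Y n i \<omega>) n x
                       - exact_cont M S t m (h K) \<psi> K n x))\<^sup>2)
          in integrable Q err \<and>
             (LINT \<omega>|Q. err \<omega>)
               \<le> (2 ^ (m - n) - 1) * ((real K + 1)\<^sup>2 / real N)
                  * const_B M S t m \<psi> K * const_A M S t m \<psi> K ^ (m - n)
                  * (LINT \<omega>|M. (\<psi> m K (S (t m) \<omega>))\<^sup>2)\<^sup>2 * (1 + \<epsilon> K)))"
proof -
  \<comment> \<open>The model is instantiated separately for each \<open>K\<close>, with the payoffs
    \<open>h K\<close> belonging to it.\<close>
  have setting: "regression_pricing M S t m (h K) \<psi> K" for K
  proof (intro regression_pricing.intro regression_pricing_axioms.intro)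
    show "S (t n) \<in> borel_measurable M" if "n \<in> {1..m}" for n
      using distributed_measurable[of M lborel "S (t n)"] density[OF that] by auto
  qed (rule assms(1-4) payoff[THEN conjunct1] basis finite_basis finite_payoff A0_const A0_mean
      A0_nonsingular B1 B3; assumption)+
  show ?thesis
    unfolding Let_def
  \<comment> \<open>The bound for fixed \<open>K\<close> carries no correction, so the zero sequence
    is the witness, independent of \<open>N\<close> and of the simulation.\<close>
  proof (intro exI[of _ "\<lambda>_. 0"] conjI ballI allI impI)
    fix n K N and Q :: "'b measure" and Y
    assume n: "n \<in> {1..m - 1}" and N: "1 \<le> N" and sim: "simulated_paths M S t m N Q Y"
    interpret regression_pricing M S t m "h K" \<psi> K by (rule setting)
    have "n \<in> {1..m}" using n by auto
    with density have g: "\<And>x. 0 \<le> g n x" "distributed M lborel (S (t n)) (\<lambda>x. ennreal (g n x))"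
      by auto
    let ?err = "\<lambda>\<omega>. (weighted_norm (g n) (\<lambda>x. est_cont M S t m (h K) \<psi> K N (\<lambda>n i. Y n i \<omega>) n x
        - exact_cont M S t m (h K) \<psi> K n x))\<^sup>2"
    show "integrable Q ?err"
      by (rule approximation_error(1)[OF sim N n g])
    show "(LINT \<omega>|Q. ?err \<omega>)
      \<le> (2 ^ (m - n) - 1) * ((real K + 1)\<^sup>2 / real N) * const_B M S t m \<psi> K * const_A M S t m \<psi> K ^ (m - n)
        * (LINT \<omega>|M. (\<psi> m K (S (t m) \<omega>))\<^sup>2)\<^sup>2 * (1 + 0)"
      using approximation_error(2)[OF sim N n g] by (simp only: p_def add_0_right mult_1_right)
  qed simp
qed

end
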